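(* Let $\varphi$ be a non-elliptic automorphism of $\mathbb{D}$ in normalized form (hyperbolic with parameter $\alpha>1$, or parabolic with parameter $t>0$) and let $J\subset\partial\mathbb{D}$ be the associated set. If $\nu_0$ is a singular measure on $\partial\mathbb{D}$ with mass concentrated in $J$, write $$\nu:=\sum_{n\in\mathbb{Z}}\nu_n,\qquad \nu_n(G)=\int_{\varphi^{(-n)}(G)}|(\varphi^{(n)})'(e^{i\theta})|\,d\nu_0(e^{i\theta})\quad (G\subset\partial\mathbb{D}\text{ Borel}).$$ Then $S_\nu$ is a singular inner function that satisfies $S_\nu(\varphi(z))=\gamma S_\nu(z)$ for all $z\in\mathbb{D}$, for some $\gamma\in\partial\mathbb{D}$. If $\varphi$ is parabolic, the same holds for $S_{\nu+a\delta_1}$ for any $a\ge0$. Conversely, every singular inner eigenvector $S_\mu$ of $C_\varphi$ has this form (that is, $\mu=\nu$ if $\varphi$ is hyperbolic and $\mu=\nu+a\delta_1$ if $\varphi$ is parabolic, with $\nu$ obtained from $\nu_0$ by $\nu=\sum_{n\in\mathbb{Z}}\nu_n$, $\nu_n(G)=\int_{\varphi^{(-n)}(G)}|(\varphi^{(n)})'(e^{i\theta})|\,d\nu_0(e^{i\theta})$ for Borel $G\subset\partial\mathbb{D}$), with $\nu_0=\chi_J\mu$ and, if $\varphi$ is parabolic, $a=\mu(\{1\})$.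
   Context: $\mathbb{D}$ is the open unit disc in $\mathbb{C}$ and $C_\varphi f=f\circ\varphi$. For $n\in\mathbb{Z}$, $\varphi^{(n)}$ is the $|n|$-th iterate of $\varphi$ if $n>0$, of $\varphi^{-1}$ if $n<0$, and the identity if $n=0$. "Singular measure" means a finite positive Borel measure on $\partial\mathbb{D}$ singular with respect to Lebesgue measure; for such $\mu$ the associated singular inner function is $$S_\mu(z)=\exp\left(-\int\frac{e^{i\theta}+z}{e^{i\theta}-z}\,d\mu(e^{i\theta})\right).$$ The zero measure is allowed, with $S_0\equiv1$. $\delta_1$ is the Dirac measure at $1$, and $\chi_J\mu$ is the restriction of $\mu$ to $J$. Normalization: let $h(z)=i\frac{1+z}{1-z}$, which maps $\mathbb{D}$ conformally onto the upper half-plane $\mathbb{C}_+$, with $h^{-1}(v)=\frac{v-i}{v+i}$. The hyperbolic automorphism (fixed points $\pm1$, with $1$ attractive) is $\varphi=h^{-1}\circ\tilde\varphi\circ h$ with $\tilde\varphi(w)=\alpha w$, $\alpha>1$; the parabolic automorphism (fixed point $1$) is $\varphi=h^{-1}\circ\tilde\varphi\circ h$ with $\tilde\varphi(w)=w+t$, $t>0$. The set $J$: in the hyperbolic case, $J=(\varphi(i),i]\cup[-i,\varphi(-i))$, the union of two half-open circular arcs of $\partial\mathbb{D}$ not containing $\pm1$ (equivalently $h(J)=(-\alpha,-1]\cup[1,\alpha)$); in the parabolic case, $J=[-1,\varphi(-1))$, the half-open circular arc of $\partial\mathbb{D}$ not containing $1$ (equivalently $h(J)=[0,t)$). *)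

theory Defs
  imports "HOL-Probability.Probability" "HOL-Complex_Analysis.Complex_Analysis"
begin

section \<open>Measures on the unit circle and singular inner functions\<close>

definition circle :: "complex measure" where
  "circle = restrict_space borel (sphere 0 1)"

definition arc_length :: "complex measure" where
  "arc_length = distr (restrict_space lborel {0..<2*pi}) circle cis"

definition singular_measure :: "complex measure \<Rightarrow> bool" where
  "singular_measure \<mu> \<longleftrightarrow> sets \<mu> = sets circle \<and> finite_measure \<mu> \<and>
     (\<exists>N \<in> sets circle. emeasure arc_length N = 0 \<and> emeasure \<mu> (sphere 0 1 - N) = 0)"

definition sing_inner :: "complex measure \<Rightarrow> complex \<Rightarrow> complex" where
  "sing_inner \<mu> z = exp (- (\<integral>\<zeta>. (\<zeta> + z) / (\<zeta> - z) \<partial>\<mu>))"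

definition singular_inner_function :: "(complex \<Rightarrow> complex) \<Rightarrow> bool" where
  "singular_inner_function f \<longleftrightarrow>
     (\<exists>\<mu>. singular_measure \<mu> \<and> (\<forall>z \<in> ball 0 1. f z = sing_inner \<mu> z))"

definition concentrated_in :: "complex measure \<Rightarrow> complex set \<Rightarrow> bool" where
  "concentrated_in \<mu> J \<longleftrightarrow> emeasure \<mu> (sphere 0 1 - J) = 0"

definition restrict_to :: "complex measure \<Rightarrow> complex set \<Rightarrow> complex measure" where
  "restrict_to \<mu> J = density \<mu> (indicator J)"

definition add_measure :: "complex measure \<Rightarrow> complex measure \<Rightarrow> complex measure" where
  "add_measure M N = measure_of (space M) (sets M) (\<lambda>G. emeasure M G + emeasure N G)"

abbreviation delta1 :: "complex measure" where
  "delta1 \<equiv> return circle 1"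


section \<open>Composition operators on functions on the unit disc\<close>

definition comp_op :: "(complex \<Rightarrow> complex) \<Rightarrow> (complex \<Rightarrow> complex) \<Rightarrow> complex \<Rightarrow> complex" where
  "comp_op \<phi> f = f \<circ> \<phi>"

definition comp_eigenvector :: "(complex \<Rightarrow> complex) \<Rightarrow> (complex \<Rightarrow> complex) \<Rightarrow> bool" where
  "comp_eigenvector \<phi> f \<longleftrightarrow> (\<exists>z \<in> ball 0 1. f z \<noteq> 0) \<and>
     (\<exists>\<gamma>. \<forall>z \<in> ball 0 1. comp_op \<phi> f z = \<gamma> * f z)"


section \<open>Normalized non-elliptic automorphisms\<close>

definition cay :: "complex \<Rightarrow> complex" where
  "cay z = \<i> * (1 + z) / (1 - z)"

definition cay_inv :: "complex \<Rightarrow> complex" where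
  "cay_inv v = (v - \<i>) / (v + \<i>)"

text \<open>
  The point \<open>1\<close> is sent to infinity by \<open>cay\<close>, and infinity is fixed by the affine maps
  \<open>g\<close> used below. As \<open>1 / 0 = 0\<close>, that point needs a separate clause. The values at points outside
  the closed unit disc where a denominator vanishes are irrelevant.
\<close>

definition disc_conj :: "(complex \<Rightarrow> complex) \<Rightarrow> complex \<Rightarrow> complex" where
  "disc_conj g z = (if z = 1 then 1 else cay_inv (g (cay z)))"

definition hyp_aut :: "real \<Rightarrow> complex \<Rightarrow> complex" where
  "hyp_aut \<alpha> = disc_conj (\<lambda>w. of_real \<alpha> * w)"

definition par_aut :: "real \<Rightarrow> complex \<Rightarrow> complex" where
  "par_aut t = disc_conj (\<lambda>w. w + of_real t)"

text \<open>
  The integer iterates, where \<open>\<psi>\<close> is the inverse of \<open>\<phi>\<close>. It is an explicit argument because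
  the total function \<open>\<phi>\<close> is invertible only on the closed disc, while \<open>deriv\<close> at a point of the
  circle needs the inverse on a full neighbourhood. The inverses of \<open>hyp_aut \<alpha>\<close> and
  \<open>par_aut t\<close> are \<open>hyp_aut (1 / \<alpha>)\<close> and \<open>par_aut (- t)\<close>; see \<open>hyp_aut_inverse\<close> and
  \<open>par_aut_inverse\<close>.
\<close>

definition aut_iter :: "(complex \<Rightarrow> complex) \<Rightarrow> (complex \<Rightarrow> complex) \<Rightarrow> int \<Rightarrow> complex \<Rightarrow> complex" where
  "aut_iter \<phi> \<psi> n = (if n \<ge> 0 then \<phi> ^^ nat n else \<psi> ^^ nat (- n))"

text \<open>
  \<open>cay\<close> maps the circle without \<open>1\<close> onto the real line, with \<open>cay \<i> = - 1\<close>, \<open>cay (- \<i>) = 1\<close>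
  and \<open>cay (- 1) = 0\<close>; see also \<open>cay_image_hyp_arc\<close> and \<open>cay_image_par_arc\<close>.
\<close>

definition hyp_arc :: "real \<Rightarrow> complex set" where
  "hyp_arc \<alpha> = {\<zeta> \<in> sphere 0 1. \<zeta> \<noteq> 1 \<and> cay \<zeta> \<in> of_real ` ({-\<alpha><..-1} \<union> {1..<\<alpha>})}"

definition par_arc :: "real \<Rightarrow> complex set" where
  "par_arc t = {\<zeta> \<in> sphere 0 1. \<zeta> \<noteq> 1 \<and> cay \<zeta> \<in> of_real ` {0..<t}}"


section \<open>The measure generated by a measure on a fundamental set\<close>

definition nu_part ::
  "(complex \<Rightarrow> complex) \<Rightarrow> (complex \<Rightarrow> complex) \<Rightarrow> complex measure \<Rightarrow> int \<Rightarrow> complex measure" where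
  "nu_part \<phi> \<psi> \<nu>\<^sub>0 n = measure_of (sphere 0 1) (sets circle)
     (\<lambda>G. \<integral>\<^sup>+ \<zeta> \<in> aut_iter \<phi> \<psi> (- n) ` G. ennreal (cmod (deriv (aut_iter \<phi> \<psi> n) \<zeta>)) \<partial>\<nu>\<^sub>0)"

text \<open>The integral over the counting measure is the sum over all integers in \<open>[0, \<infinity>]\<close>.\<close>

definition nu ::
  "(complex \<Rightarrow> complex) \<Rightarrow> (complex \<Rightarrow> complex) \<Rightarrow> complex measure \<Rightarrow> complex measure" where
  "nu \<phi> \<psi> \<nu>\<^sub>0 = measure_of (sphere 0 1) (sets circle)
     (\<lambda>G. \<integral>\<^sup>+ n. emeasure (nu_part \<phi> \<psi> \<nu>\<^sub>0 n) G \<partial>count_space (UNIV :: int set))"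


section \<open>Consistency of the definitions\<close>

lemma space_circle [simp]: "space circle = sphere 0 1"
  by (simp add: circle_def space_restrict_space)

lemma sets_circle: "sets circle = {G. G \<in> sets borel \<and> G \<subseteq> sphere 0 1}"
  unfolding circle_def sets_restrict_space by (auto simp: image_iff intro: sets.Int)

lemma cis_measurable: "cis \<in> measurable (restrict_space lborel {0..<2*pi}) circle"
proof -
  have "cis \<in> borel_measurable lborel"
    using borel_measurable_continuous_onI[OF continuous_on_cis[OF continuous_on_id]] by simp
  then show ?thesis
    unfolding circle_def by (intro measurable_restrict_space2 measurable_restrict_space1) auto
qed

lemma cay_cay_inv: "cay (cay_inv v) = v" if "v \<noteq> -\<i>"
proof -
  have nz: "v + \<i> \<noteq> 0" using that by (simp add: add_eq_0_iff2)
  have "1 + cay_inv v = 2 * v / (v + \<i>)" "1 - cay_inv v = 2 * \<i> / (v + \<i>)"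
    using nz by (simp_all add: cay_inv_def field_simps)
  then show ?thesis using nz by (simp add: cay_def)
qed

lemma cay_inv_cay: "cay_inv (cay z) = z" if "z \<noteq> 1"
proof -
  have nz: "1 - z \<noteq> 0" using that by simp
  have "cay z - \<i> = 2 * \<i> * z / (1 - z)" "cay z + \<i> = 2 * \<i> / (1 - z)"
    using nz by (simp_all add: cay_def field_simps)
  then show ?thesis using nz by (simp add: cay_inv_def)
qed

lemma cay_inv_neq_1: "cay_inv v \<noteq> 1"
proof (cases "v + \<i> = 0")
  case False
  then have "cay_inv v - 1 = - 2 * \<i> / (v + \<i>)" by (simp add: cay_inv_def field_simps)
  then show ?thesis using False by auto
qed (simp add: cay_inv_def)

lemma cay_inv_norm: "cmod (cay_inv v) \<le> 1 \<longleftrightarrow> 0 \<le> Im v"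
  "cmod (cay_inv v) = 1 \<longleftrightarrow> Im v = 0" if "v \<noteq> -\<i>"
proof -
  have pos: "cmod (v + \<i>) > 0" using that by (simp add: add_eq_0_iff2)
  have d: "(cmod (v + \<i>))\<^sup>2 - (cmod (v - \<i>))\<^sup>2 = 4 * Im v"
    by (simp add: cmod_power2) (simp add: power2_eq_square algebra_simps)
  have "cmod (cay_inv v) \<le> 1 \<longleftrightarrow> cmod (v - \<i>) \<le> cmod (v + \<i>)"
    "cmod (cay_inv v) = 1 \<longleftrightarrow> cmod (v - \<i>) = cmod (v + \<i>)"
    using pos by (simp_all add: cay_inv_def norm_divide divide_simps)
  moreover have "cmod (v - \<i>) \<le> cmod (v + \<i>) \<longleftrightarrow> (cmod (v - \<i>))\<^sup>2 \<le> (cmod (v + \<i>))\<^sup>2"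
    by simp
  moreover have "cmod (v - \<i>) = cmod (v + \<i>) \<longleftrightarrow> (cmod (v - \<i>))\<^sup>2 = (cmod (v + \<i>))\<^sup>2"
    by simp
  ultimately show "cmod (cay_inv v) \<le> 1 \<longleftrightarrow> 0 \<le> Im v" "cmod (cay_inv v) = 1 \<longleftrightarrow> Im v = 0"
    using d by linarith+
qed

lemma cay_neq: "cay z \<noteq> -\<i>" if "z \<noteq> 1"
  using that by (auto simp: cay_def field_simps)

lemma Im_cay: "0 \<le> Im (cay z) \<longleftrightarrow> cmod z \<le> 1" "Im (cay z) = 0 \<longleftrightarrow> cmod z = 1" if "z \<noteq> 1"
  using cay_inv_norm[OF cay_neq[OF that]] cay_inv_cay[OF that] by simp_all

lemma cay_image_arc:
  "cay ` {\<zeta> \<in> sphere 0 1. \<zeta> \<noteq> 1 \<and> cay \<zeta> \<in> of_real ` I} = of_real ` I"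
proof -
  have "complex_of_real x \<in> cay ` {\<zeta> \<in> sphere 0 1. \<zeta> \<noteq> 1 \<and> cay \<zeta> \<in> of_real ` I}"
    if "x \<in> I" for x
  proof (rule image_eqI[of _ _ "cay_inv (of_real x)"])
    have "complex_of_real x \<noteq> -\<i>" by (simp add: complex_eq_iff)
    then show "complex_of_real x = cay (cay_inv (of_real x))"
      "cay_inv (of_real x) \<in> {\<zeta> \<in> sphere 0 1. \<zeta> \<noteq> 1 \<and> cay \<zeta> \<in> of_real ` I}"
      using that cay_inv_norm(2)[of "of_real x"] by (auto simp: cay_cay_inv cay_inv_neq_1)
  qed
  then show ?thesis by auto
qed

lemma cay_image_hyp_arc: "cay ` hyp_arc \<alpha> = of_real ` ({-\<alpha><..-1} \<union> {1..<\<alpha>})"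
  unfolding hyp_arc_def by (rule cay_image_arc)

lemma cay_image_par_arc: "cay ` par_arc t = of_real ` {0..<t}"
  unfolding par_arc_def by (rule cay_image_arc)

lemma arc_measurable:
  assumes "I \<in> sets (borel :: real measure)"
  shows "{\<zeta> \<in> sphere 0 1. \<zeta> \<noteq> 1 \<and> cay \<zeta> \<in> of_real ` I} \<in> sets circle"
proof -
  have [measurable]: "cay \<in> borel_measurable borel" unfolding cay_def by measurable
  have "of_real ` I = {w. Im w = 0} \<inter> Re -` I"
    by (auto simp: image_iff complex_eq_iff)
  moreover have "closed {w. Im w = 0}"
    using closed_hyperplane[of \<i> 0] by (simp add: inner_complex_def)
  moreover have "Re -` I \<inter> space borel \<in> sets borel"
    using assms by (intro measurable_sets[where A = borel]) auto
  ultimately have "(of_real ` I :: complex set) \<in> sets borel"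
    by auto
  then have "cay -` (of_real ` I) \<inter> space borel \<in> sets borel"
    by (intro measurable_sets[where A = borel]) auto
  then have "sphere 0 1 \<inter> (- {1}) \<inter> cay -` (of_real ` I) \<in> sets borel"
    by (intro sets.Int) (auto simp: borel_closed)
  moreover have "sphere 0 1 \<inter> (- {1}) \<inter> cay -` (of_real ` I) =
      {\<zeta> \<in> sphere 0 1. \<zeta> \<noteq> 1 \<and> cay \<zeta> \<in> of_real ` I}"
    by auto
  ultimately show ?thesis
    unfolding sets_circle by auto
qed

lemma hyp_arc_measurable: "hyp_arc \<alpha> \<in> sets circle"
  unfolding hyp_arc_def by (rule arc_measurable) simp

lemma par_arc_measurable: "par_arc t \<in> sets circle"
  unfolding par_arc_def by (rule arc_measurable) simp

lemma disc_conj_inverse: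
  assumes "cmod z \<le> 1" "\<And>w. Im w \<ge> 0 \<Longrightarrow> Im (g w) \<ge> 0" "\<And>w. f (g w) = w"
  shows "disc_conj f (disc_conj g z) = z"
proof (cases "z = 1")
  case False
  have "Im (g (cay z)) \<ge> 0" using assms(1,2) Im_cay(1)[OF False] by simp
  then have "g (cay z) \<noteq> -\<i>" by auto
  then show ?thesis
    using False by (simp add: disc_conj_def cay_inv_neq_1 cay_cay_inv assms(3) cay_inv_cay)
qed (simp add: disc_conj_def)

lemma hyp_aut_inverse:
  assumes "\<alpha> > 0" "z \<in> cball 0 1"
  shows "hyp_aut (1 / \<alpha>) (hyp_aut \<alpha> z) = z" "hyp_aut \<alpha> (hyp_aut (1 / \<alpha>) z) = z"
  using assms unfolding hyp_aut_def by (intro disc_conj_inverse; simp)+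

lemma par_aut_inverse:
  assumes "z \<in> cball 0 1"
  shows "par_aut (- t) (par_aut t z) = z" "par_aut t (par_aut (- t) z) = z"
  using assms unfolding par_aut_def by (intro disc_conj_inverse; simp)+

lemma disc_conj_sphere:
  assumes "z \<in> sphere 0 1" "\<And>w. Im w = 0 \<Longrightarrow> Im (g w) = 0"
  shows "disc_conj g z \<in> sphere 0 1"
proof (cases "z = 1")
  case False
  have "Im (g (cay z)) = 0" using assms Im_cay(2)[OF False] by simp
  moreover from this have "g (cay z) \<noteq> -\<i>" by auto
  ultimately show ?thesis using False cay_inv_norm(2) by (simp add: disc_conj_def)
qed (simp add: disc_conj_def)

lemma disc_conj_analytic:
  assumes "g analytic_on UNIV" "\<And>w. Im w = 0 \<Longrightarrow> Im (g w) = 0"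
  shows "disc_conj g analytic_on (sphere 0 1 - {1})"
proof -
  have "disc_conj g analytic_on {z}" if z: "z \<in> sphere 0 1 - {1}" for z
  proof -
    have "z \<noteq> 1" "Im (g (cay z)) = 0" using z assms(2) Im_cay(2)[of z] by auto
    then have nz: "1 - z \<noteq> 0" "g (cay z) + \<i> \<noteq> 0" by (auto simp: complex_eq_iff)
    have "cay analytic_on {z}"
      unfolding cay_def using nz by (intro analytic_intros) auto
    then have "(\<lambda>z. g (cay z)) analytic_on {z}"
      using analytic_on_compose_gen[of cay "{z}" g UNIV] assms(1) by (simp add: o_def)
    then have "(\<lambda>z. cay_inv (g (cay z))) analytic_on {z}"
      unfolding cay_inv_def using nz by (intro analytic_intros) auto
    moreover have "\<forall>\<^sub>F w in nhds z. w \<noteq> 1"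
      using \<open>z \<noteq> 1\<close> by (rule t1_space_nhds)
    then have "\<forall>\<^sub>F w in nhds z. disc_conj g w = cay_inv (g (cay w))"
      by eventually_elim (simp add: disc_conj_def)
    ultimately show ?thesis
      using analytic_at_cong[of "disc_conj g" "\<lambda>w. cay_inv (g (cay w))" z z] by simp
  qed
  then show ?thesis using analytic_on_analytic_at by blast
qed

definition circle_inverses :: "(complex \<Rightarrow> complex) \<Rightarrow> (complex \<Rightarrow> complex) \<Rightarrow> bool" where
  "circle_inverses \<phi> \<psi> \<longleftrightarrow> \<phi> \<in> borel_measurable borel \<and> \<psi> \<in> borel_measurable borel \<and>
     \<phi> 1 = 1 \<and> \<psi> 1 = 1 \<and>
     \<phi> analytic_on (sphere 0 1 - {1}) \<and> \<psi> analytic_on (sphere 0 1 - {1}) \<and>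
     (\<forall>z \<in> sphere 0 1. \<phi> z \<in> sphere 0 1 \<and> \<psi> z \<in> sphere 0 1 \<and> \<psi> (\<phi> z) = z \<and> \<phi> (\<psi> z) = z)"

lemma circle_inverses_hyp: "\<alpha> > 0 \<Longrightarrow> circle_inverses (hyp_aut \<alpha>) (hyp_aut (1 / \<alpha>))"
proof -
  assume a: "\<alpha> > 0"
  have m: "hyp_aut b \<in> borel_measurable borel" for b
    unfolding hyp_aut_def disc_conj_def cay_def cay_inv_def by measurable
  have s: "hyp_aut b z \<in> sphere 0 1" if "z \<in> sphere 0 1" for b z
    unfolding hyp_aut_def using that by (rule disc_conj_sphere) simp
  have "hyp_aut b analytic_on (sphere 0 1 - {1})" for b
    unfolding hyp_aut_def by (intro disc_conj_analytic analytic_intros) simp_all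
  moreover have "hyp_aut b 1 = 1" for b
    by (simp add: hyp_aut_def disc_conj_def)
  ultimately show ?thesis
    using m s hyp_aut_inverse[OF a] unfolding circle_inverses_def
    by (meson subsetD sphere_cball)
qed

lemma circle_inverses_par: "circle_inverses (par_aut t) (par_aut (- t))"
proof -
  have m: "par_aut b \<in> borel_measurable borel" for b
    unfolding par_aut_def disc_conj_def cay_def cay_inv_def by measurable
  have s: "par_aut b z \<in> sphere 0 1" if "z \<in> sphere 0 1" for b z
    unfolding par_aut_def using that by (rule disc_conj_sphere) simp
  have "par_aut b analytic_on (sphere 0 1 - {1})" for b
    unfolding par_aut_def by (intro disc_conj_analytic analytic_intros) simp_all
  moreover have "par_aut b 1 = 1" for b
    by (simp add: par_aut_def disc_conj_def)
  ultimately show ?thesis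
    using m s par_aut_inverse unfolding circle_inverses_def
    by (meson subsetD sphere_cball)
qed

lemma aut_iter_circle:
  assumes "circle_inverses \<phi> \<psi>"
  shows "aut_iter \<phi> \<psi> n \<in> borel_measurable borel"
    and "z \<in> sphere 0 1 \<Longrightarrow> aut_iter \<phi> \<psi> n z \<in> sphere 0 1"
    and "z \<in> sphere 0 1 \<Longrightarrow> aut_iter \<phi> \<psi> (- n) (aut_iter \<phi> \<psi> n z) = z"
proof -
  have pow: "f ^^ k \<in> borel_measurable borel \<and> (\<forall>z \<in> sphere 0 1. (f ^^ k) z \<in> sphere 0 1) \<and>
      (\<forall>z \<in> sphere 0 1. (g ^^ k) ((f ^^ k) z) = z)"
    if "circle_inverses f g" for f g and k :: nat
  proof (induction k)
    case (Suc k)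
    have "(g ^^ Suc k) ((f ^^ Suc k) z) = z" if "z \<in> sphere 0 1" for z
    proof -
      have "(f ^^ k) z \<in> sphere 0 1" "(g ^^ k) ((f ^^ k) z) = z" using Suc that by auto
      moreover have "(g ^^ Suc k) ((f ^^ Suc k) z) = (g ^^ k) (g (f ((f ^^ k) z)))"
        unfolding funpow_Suc_right[of k g] by simp
      ultimately show ?thesis
        using \<open>circle_inverses f g\<close> unfolding circle_inverses_def by metis
    qed
    moreover have "f ^^ Suc k \<in> borel_measurable borel"
      using Suc \<open>circle_inverses f g\<close> measurable_comp[of "f ^^ k" borel borel f borel]
      by (simp add: circle_inverses_def)
    moreover have "\<forall>z \<in> sphere 0 1. (f ^^ Suc k) z \<in> sphere 0 1"
      using Suc \<open>circle_inverses f g\<close> by (simp add: circle_inverses_def)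
    ultimately show ?case by blast
  qed auto
  have inv: "circle_inverses \<psi> \<phi>" using assms by (auto simp: circle_inverses_def)
  note P = pow[OF assms] pow[OF inv]
  show "aut_iter \<phi> \<psi> n \<in> borel_measurable borel"
    using P by (simp add: aut_iter_def)
  show "z \<in> sphere 0 1 \<Longrightarrow> aut_iter \<phi> \<psi> n z \<in> sphere 0 1"
    using P by (simp add: aut_iter_def)
  show "z \<in> sphere 0 1 \<Longrightarrow> aut_iter \<phi> \<psi> (- n) (aut_iter \<phi> \<psi> n z) = z"
    using P by (cases "n = 0") (auto simp: aut_iter_def)
qed

lemma aut_iter_image:
  assumes "circle_inverses \<phi> \<psi>" "G \<subseteq> sphere 0 1"
  shows "aut_iter \<phi> \<psi> (- n) ` G = {z \<in> sphere 0 1. aut_iter \<phi> \<psi> n z \<in> G}"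
proof -
  have "aut_iter \<phi> \<psi> n (aut_iter \<phi> \<psi> (- n) z) = z" if "z \<in> sphere 0 1" for z
    using aut_iter_circle(3)[OF assms(1) that, of "- n"] by simp
  moreover have "z \<in> aut_iter \<phi> \<psi> (- n) ` G" if "z \<in> sphere 0 1" "aut_iter \<phi> \<psi> n z \<in> G" for z
    using aut_iter_circle(3)[OF assms(1) that(1), of n] that(2) by (metis imageI)
  ultimately show ?thesis
    using assms(2) aut_iter_circle(2)[OF assms(1)] by (auto simp del: mem_sphere_0)
qed

lemma aut_iter_analytic:
  assumes "circle_inverses \<phi> \<psi>"
  shows "aut_iter \<phi> \<psi> n analytic_on (sphere 0 1 - {1})"
proof -
  have pow: "f ^^ k analytic_on (sphere 0 1 - {1}) \<and>
      (\<forall>z \<in> sphere 0 1 - {1}. (f ^^ k) z \<in> sphere 0 1 - {1})"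
    if fg: "circle_inverses f g" for f g and k :: nat
  proof (induction k)
    case (Suc k)
    have "f z \<in> sphere 0 1 - {1}" if "z \<in> sphere 0 1 - {1}" for z
      using fg that unfolding circle_inverses_def by (metis Diff_iff singletonD singletonI)
    moreover have "f analytic_on (sphere 0 1 - {1})"
      using fg by (simp add: circle_inverses_def)
    then have "f \<circ> f ^^ k analytic_on (sphere 0 1 - {1})"
      using Suc by (intro analytic_on_compose_gen) auto
    ultimately show ?case using Suc by (simp add: o_def)
  qed (simp add: id_def)
  have "circle_inverses \<psi> \<phi>" using assms by (auto simp: circle_inverses_def)
  then show ?thesis using pow[OF assms] pow[of \<psi> \<phi>] by (simp add: aut_iter_def)
qed

lemma deriv_aut_iter_measurable:
  assumes "circle_inverses \<phi> \<psi>"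
  shows "deriv (aut_iter \<phi> \<psi> n) \<in> borel_measurable circle"
proof -
  let ?d = "deriv (aut_iter \<phi> \<psi> n)"
  have "continuous_on (sphere 0 1 - {1}) ?d"
    using aut_iter_analytic[OF assms]
    by (intro holomorphic_on_imp_continuous_on analytic_imp_holomorphic analytic_deriv)
  then have "?d \<in> borel_measurable (restrict_space borel (sphere 0 1 - {1}))"
    by (rule borel_measurable_continuous_on_restrict)
  moreover have "restrict_space circle (- {1}) = restrict_space borel (sphere 0 1 - {1})"
    unfolding circle_def by (subst restrict_restrict_space) (auto simp: borel_closed Diff_eq)
  ultimately have "?d \<in> borel_measurable (restrict_space circle (- {1}))"
    by simp
  moreover have "?d \<in> borel_measurable (restrict_space circle {1})"
    by (subst measurable_cong[where g = "\<lambda>_. ?d 1"]) (auto simp: space_restrict_space)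
  moreover have "{1} \<in> sets circle" by (simp add: sets_circle)
  then have "\<Omega> \<inter> space circle \<in> sets circle" if "\<Omega> \<in> {{1}, - {1}}" for \<Omega> :: "complex set"
    using that by (auto simp: sets_circle)
  ultimately show ?thesis
    by (intro measurable_piecewise_restrict[of "{{1}, - {1}}" circle]) blast+
qed

lemma sets_nu_part [simp]: "sets (nu_part \<phi> \<psi> \<nu>\<^sub>0 n) = sets circle"
  unfolding nu_part_def by (metis sets.sets_measure_of_eq space_circle)

lemma sets_nu [simp]: "sets (nu \<phi> \<psi> \<nu>\<^sub>0) = sets circle"
  unfolding nu_def by (metis sets.sets_measure_of_eq space_circle)

text \<open>
  \<open>measure_of\<close> returns the zero measure unless its argument is countably additive; the next lemmas
  show that this never happens here.
\<close>

lemma emeasure_nu_part: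
  assumes inv: "circle_inverses \<phi> \<psi>" and sets: "sets \<nu>\<^sub>0 = sets circle"
    and G: "G \<in> sets circle"
  shows "emeasure (nu_part \<phi> \<psi> \<nu>\<^sub>0 n) G =
    (\<integral>\<^sup>+ \<zeta> \<in> aut_iter \<phi> \<psi> (- n) ` G. ennreal (cmod (deriv (aut_iter \<phi> \<psi> n) \<zeta>)) \<partial>\<nu>\<^sub>0)"
proof (rule emeasure_measure_of[OF nu_part_def])
  define f where "f \<zeta> = ennreal (cmod (deriv (aut_iter \<phi> \<psi> n) \<zeta>))" for \<zeta>
  let ?im = "\<lambda>G. aut_iter \<phi> \<psi> (- n) ` G"
  have [measurable]: "deriv (aut_iter \<phi> \<psi> n) \<in> borel_measurable \<nu>\<^sub>0"
    using deriv_aut_iter_measurable[OF inv, of n] sets measurable_cong_sets[of \<nu>\<^sub>0 circle] by blast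
  have f: "f \<in> borel_measurable \<nu>\<^sub>0"
    unfolding f_def by measurable
  have im: "?im G \<in> sets \<nu>\<^sub>0" if "G \<in> sets circle" for G
  proof -
    have "aut_iter \<phi> \<psi> n -` G \<inter> space borel \<in> sets borel"
      using that aut_iter_circle(1)[OF inv] by (intro measurable_sets[where A = borel]) (auto simp: sets_circle)
    then have "sphere 0 1 \<inter> aut_iter \<phi> \<psi> n -` G \<in> sets borel"
      by (intro sets.Int) (auto simp: borel_closed)
    moreover have "?im G = sphere 0 1 \<inter> aut_iter \<phi> \<psi> n -` G"
      using that aut_iter_image[OF inv, of G n] by (auto simp: sets_circle)
    ultimately show ?thesis
      unfolding sets sets_circle by auto
  qed
  have eq: "(\<integral>\<^sup>+ \<zeta> \<in> ?im G. f \<zeta> \<partial>\<nu>\<^sub>0) = emeasure (density \<nu>\<^sub>0 f) (?im G)" if "G \<in> sets circle" for G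
    using emeasure_density[OF f im[OF that]] by simp
  show "countably_additive (sets (nu_part \<phi> \<psi> \<nu>\<^sub>0 n))
      (\<lambda>G. \<integral>\<^sup>+ \<zeta> \<in> ?im G. ennreal (cmod (deriv (aut_iter \<phi> \<psi> n) \<zeta>)) \<partial>\<nu>\<^sub>0)"
    unfolding countably_additive_def f_def[symmetric] sets_nu_part
  proof (intro allI impI)
    fix A :: "nat \<Rightarrow> complex set"
    assume A: "range A \<subseteq> sets circle" "disjoint_family A" "(\<Union>i. A i) \<in> sets circle"
    have "?im (A i) = {z \<in> sphere 0 1. aut_iter \<phi> \<psi> n z \<in> A i}" for i
      using A(1) by (intro aut_iter_image[OF inv]) (auto simp: sets_circle)
    then have "disjoint_family (\<lambda>i. ?im (A i))"
      using A(2) unfolding disjoint_family_on_def by blast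
    moreover have "range (\<lambda>i. ?im (A i)) \<subseteq> sets (density \<nu>\<^sub>0 f)"
      using A(1) im by auto
    ultimately have "(\<Sum>i. emeasure (density \<nu>\<^sub>0 f) (?im (A i))) =
        emeasure (density \<nu>\<^sub>0 f) (\<Union>i. ?im (A i))"
      by (intro suminf_emeasure)
    also have "(\<Union>i. ?im (A i)) = ?im (\<Union>i. A i)"
      by (simp add: image_UN)
    finally show "(\<Sum>i. \<integral>\<^sup>+ \<zeta> \<in> ?im (A i). f \<zeta> \<partial>\<nu>\<^sub>0) = (\<integral>\<^sup>+ \<zeta> \<in> ?im (\<Union>i. A i). f \<zeta> \<partial>\<nu>\<^sub>0)"
      using A(1,3) by (simp add: eq range_subsetD)
  qed
  show "sets circle \<subseteq> Pow (sphere 0 1)" by (auto simp: sets_circle)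
qed (use G in \<open>auto simp: positive_def\<close>)

lemma emeasure_nu:
  assumes "G \<in> sets circle"
  shows "emeasure (nu \<phi> \<psi> \<nu>\<^sub>0) G =
    (\<integral>\<^sup>+ n. emeasure (nu_part \<phi> \<psi> \<nu>\<^sub>0 n) G \<partial>count_space (UNIV :: int set))"
proof (rule emeasure_measure_of[OF nu_def])
  show "countably_additive (sets (nu \<phi> \<psi> \<nu>\<^sub>0))
      (\<lambda>G. \<integral>\<^sup>+ n. emeasure (nu_part \<phi> \<psi> \<nu>\<^sub>0 n) G \<partial>count_space (UNIV :: int set))"
    by (auto simp: countably_additive_def suminf_emeasure nn_integral_suminf[symmetric])
qed (use assms in \<open>auto simp: positive_def sets_circle\<close>)

lemma emeasure_add_measure:
  assumes "sets M = sets N" "G \<in> sets M"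
  shows "emeasure (add_measure M N) G = emeasure M G + emeasure N G"
proof (rule emeasure_measure_of[OF add_measure_def])
  have "sets (add_measure M N) = sets M"
    by (simp add: add_measure_def)
  then show "G \<in> sets (add_measure M N)"
    "countably_additive (sets (add_measure M N)) (\<lambda>G. emeasure M G + emeasure N G)"
    using assms by (auto simp: countably_additive_def suminf_emeasure suminf_add[symmetric])
qed (auto simp: positive_def sets.space_closed)

end

theory Submission
  imports Defs
begin

text \<open>
  Put \<open>F\<^sub>\<mu> z = \<integral> (\<zeta> + z) / (\<zeta> - z) d\<mu>(\<zeta>)\<close>, so that \<open>S\<^sub>\<mu> = exp (- F\<^sub>\<mu>)\<close>, and let an automorphism
  \<open>\<phi>\<close> of the disc act on measures by \<open>\<mu> \<mapsto> \<phi>\<^sub>*(\<bar>\<phi>'\<bar> \<mu>)\<close>; this action is called \<open>push\<close> below, and \<open>\<nu>\<^sub>n\<close> is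
  the image of \<open>\<nu>\<^sub>0\<close> under the action of the \<open>n\<close>-th iterate. The proof reduces the theorem to a
  statement about invariant measures: for singular \<open>\<mu>\<close>, the function \<open>S\<^sub>\<mu>\<close> is an eigenvector of
  \<open>C\<^sub>\<phi>\<close> if and only if \<open>push \<mu> = \<mu>\<close>.

  The link is an identity for the Herglotz kernel (\<open>herglotz_kernel_mob\<close>): its value at
  \<open>(\<phi> \<zeta>, \<phi> z)\<close>, multiplied by \<open>\<bar>\<phi>' \<zeta>\<bar>\<close>, differs from its value at \<open>(\<zeta>, z)\<close> by a purely imaginary
  number that does not depend on \<open>z\<close>. Integration gives \<open>F\<^bsub>push \<mu>\<^esub> \<circ> \<phi> = F\<^sub>\<mu> + \<kappa>\<close> with imaginary
  \<open>\<kappa>\<close>, so an invariant \<open>\<mu>\<close> yields an eigenvector with unimodular eigenvalue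
  (\<open>invariant_imp_eigen\<close>). Conversely, if \<open>exp (- F\<^sub>\<mu> \<circ> \<phi>)\<close> is a multiple of \<open>exp (- F\<^sub>\<mu>)\<close>, then
  \<open>F\<^sub>\<mu> \<circ> \<phi> - F\<^sub>\<mu>\<close> is constant by connectedness of the disc, hence \<open>F\<^bsub>push \<mu>\<^esub> - F\<^sub>\<mu>\<close> is
  constant. The Taylor coefficients of \<open>F\<^sub>\<mu>\<close> are the Fourier coefficients of \<open>\<mu>\<close>, so
  \<open>push \<mu>\<close> and \<open>\<mu>\<close> can differ only by a multiple of arc length, and for two singular measures this
  multiple vanishes (\<open>eigen_imp_invariant\<close>). The same uniqueness statement, applied to arc length
  itself, shows that \<open>push\<close> preserves singularity.

  What remains is dynamics on the circle. In the coordinate \<open>cay\<close> the automorphism is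
  \<open>x \<mapsto> \<alpha> x\<close> or \<open>x \<mapsto> x + t\<close> on the real line, and \<open>J\<close> is a fundamental domain for the group that it
  generates. The sum of the translates of a measure on \<open>J\<close> is invariant by reindexing; its mass is
  finite because \<open>\<bar>(\<phi>\<^sup>n)'\<bar>\<close> is bounded on \<open>J\<close> by a summable sequence, geometric in the hyperbolic case and
  of order \<open>1 / n\<^sup>2\<close> in the parabolic one. Conversely, an invariant measure is the sum of
  the translates of its restriction to \<open>J\<close>, except for its mass at the fixed points
  (\<open>nu_restrict_invariant\<close>). Invariance at a fixed point \<open>p\<close> reads \<open>\<mu>{p} = \<bar>\<phi>' p\<bar> \<mu>{p}\<close>. In the
  hyperbolic case the derivatives at \<open>1\<close> and \<open>-1\<close> are \<open>1 / \<alpha>\<close> and \<open>\<alpha>\<close>, so there is no such mass; in the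
  parabolic case \<open>\<phi>' 1 = 1\<close>, and the point mass at \<open>1\<close> is arbitrary.
\<close>

section \<open>Finite measures on the circle and their moments\<close>

locale circle_measure = finite_measure M for M :: "complex measure" +
  assumes sets_M [measurable_cong, simp]: "sets M = sets circle"
begin

lemma space_M [simp]: "space M = sphere 0 1"
  using sets_eq_imp_space_eq[OF sets_M] by simp

lemma measurable_continuous:
  fixes f :: "complex \<Rightarrow> 'b::topological_space"
  assumes "continuous_on (sphere 0 1) f"
  shows "f \<in> borel_measurable M"
proof -
  have "f \<in> borel_measurable circle"
    unfolding circle_def using assms by (rule borel_measurable_continuous_on_restrict)
  then show ?thesis
    using measurable_cong_sets[OF sets_M refl] by blast
qed

lemma integrable_continuous:
  fixes f :: "complex \<Rightarrow> 'b::{banach, second_countable_topology}"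
  assumes "continuous_on (sphere 0 1) f"
  shows "integrable M f"
proof -
  have "bounded (f ` sphere 0 1)"
    using assms by (intro compact_imp_bounded compact_continuous_image) auto
  then obtain B where "\<forall>\<zeta>\<in>sphere 0 1. norm (f \<zeta>) \<le> B"
    by (auto simp: bounded_iff)
  then show ?thesis
    by (intro integrable_const_bound[where B = B] measurable_continuous assms) auto
qed

end

lemma cnj_eq_inverse_circle: "\<zeta> \<in> sphere 0 1 \<Longrightarrow> \<zeta> * cnj \<zeta> = 1"
  by (metis complex_norm_square mem_sphere_0 of_real_1 power_one)

text \<open>
  On the circle \<open>cnj \<zeta> = 1 / \<zeta>\<close>, so polynomials in the real and imaginary part are Laurent polynomials.
  Writing these as \<open>cnj \<zeta> ^ m * poly q \<zeta>\<close> makes closure under sums and products a matter of taking a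
  common \<open>m\<close>. This form connects the Stone-Weierstrass theorem, which speaks of
  real polynomial functions, with Fourier coefficients.
\<close>

lemma real_polynomial_function_circle:
  assumes "real_polynomial_function p"
  shows "\<exists>q m. \<forall>\<zeta>\<in>sphere 0 1. complex_of_real (p \<zeta>) = cnj \<zeta> ^ m * poly q \<zeta>"
  using assms
proof induction
  case (linear f)
  interpret f: bounded_linear f by fact
  define u where "u = Complex (f 1) (- f \<i>) / 2"
  have "complex_of_real (f \<zeta>) = cnj \<zeta> ^ 1 * poly [:cnj u, 0, u:] \<zeta>" if "\<zeta> \<in> sphere 0 1" for \<zeta>
  proof -
    have "f \<zeta> = f (Re \<zeta> *\<^sub>R 1 + Im \<zeta> *\<^sub>R \<i>)"
      by (intro arg_cong[of _ _ f]) (simp add: complex_eq_iff)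
    also have "\<dots> = Re \<zeta> * f 1 + Im \<zeta> * f \<i>"
      by (simp add: f.add f.scaleR)
    finally have "complex_of_real (f \<zeta>) = u * \<zeta> + cnj u * cnj \<zeta>"
      by (simp add: u_def complex_eq_iff field_simps)
    also have "\<dots> = cnj \<zeta> * cnj u + (\<zeta> * cnj \<zeta>) * (\<zeta> * u)"
      using cnj_eq_inverse_circle[OF that] by simp
    also have "\<dots> = cnj \<zeta> ^ 1 * poly [:cnj u, 0, u:] \<zeta>"
      by (simp add: algebra_simps)
    finally show ?thesis .
  qed
  then show ?case by blast
next
  case (const c)
  have "complex_of_real c = cnj \<zeta> ^ 0 * poly [:of_real c:] \<zeta>" for \<zeta>
    by simp
  then show ?case by blast
next
  case (add f g)
  then obtain p m q n
    where f: "\<And>\<zeta>. \<zeta>\<in>sphere 0 1 \<Longrightarrow> complex_of_real (f \<zeta>) = cnj \<zeta> ^ m * poly p \<zeta>"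
      and g: "\<And>\<zeta>. \<zeta>\<in>sphere 0 1 \<Longrightarrow> complex_of_real (g \<zeta>) = cnj \<zeta> ^ n * poly q \<zeta>"
    by blast
  have "complex_of_real (f \<zeta> + g \<zeta>) = cnj \<zeta> ^ (m + n) * poly (monom 1 n * p + monom 1 m * q) \<zeta>"
    if "\<zeta> \<in> sphere 0 1" for \<zeta>
  proof -
    have "cnj \<zeta> ^ (m + n) * poly (monom 1 n * p + monom 1 m * q) \<zeta> =
        (\<zeta> * cnj \<zeta>) ^ n * (cnj \<zeta> ^ m * poly p \<zeta>) + (\<zeta> * cnj \<zeta>) ^ m * (cnj \<zeta> ^ n * poly q \<zeta>)"
      by (simp add: poly_monom power_add power_mult_distrib algebra_simps)
    then show ?thesis
      using f g that cnj_eq_inverse_circle[OF that] by simp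
  qed
  then show ?case by blast
next
  case (mult f g)
  then obtain p m q n
    where f: "\<And>\<zeta>. \<zeta>\<in>sphere 0 1 \<Longrightarrow> complex_of_real (f \<zeta>) = cnj \<zeta> ^ m * poly p \<zeta>"
      and g: "\<And>\<zeta>. \<zeta>\<in>sphere 0 1 \<Longrightarrow> complex_of_real (g \<zeta>) = cnj \<zeta> ^ n * poly q \<zeta>"
    by blast
  have "complex_of_real (f \<zeta> * g \<zeta>) = cnj \<zeta> ^ (m + n) * poly (p * q) \<zeta>"
    if "\<zeta> \<in> sphere 0 1" for \<zeta>
    using f[OF that] g[OF that] by (simp add: power_add)
  then show ?case by blast
qed

text \<open>
  The Fourier coefficient of index \<open>n\<close>. The coefficients of negative index are the complex
  conjugates of these, as measures are positive.
\<close>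

definition moment :: "complex measure \<Rightarrow> nat \<Rightarrow> complex" where
  "moment M n = (\<integral>\<zeta>. cnj \<zeta> ^ n \<partial>M)"

lemma (in circle_measure) integral_laurent:
  "(\<integral>\<zeta>. cnj \<zeta> ^ m * poly q \<zeta> \<partial>M) =
    (\<Sum>i\<le>degree q. coeff q i * (if i \<le> m then moment M (m - i) else cnj (moment M (i - m))))"
proof -
  have mono: "cnj \<zeta> ^ m * \<zeta> ^ i = (if i \<le> m then cnj \<zeta> ^ (m - i) else cnj (cnj \<zeta> ^ (i - m)))"
    if "\<zeta> \<in> sphere 0 1" for \<zeta> i
  proof (cases "i \<le> m")
    case True
    then have "cnj \<zeta> ^ m * \<zeta> ^ i = cnj \<zeta> ^ (m - i) * (\<zeta> * cnj \<zeta>) ^ i"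
      by (simp add: power_mult_distrib flip: power_add)
    then show ?thesis using True cnj_eq_inverse_circle[OF that] by simp
  next
    case False
    then have "cnj \<zeta> ^ m * \<zeta> ^ i = \<zeta> ^ (i - m) * (\<zeta> * cnj \<zeta>) ^ m"
      by (simp add: power_mult_distrib flip: power_add)
    then show ?thesis using False cnj_eq_inverse_circle[OF that] by simp
  qed
  have term_eq: "(\<integral>\<zeta>. cnj \<zeta> ^ m * \<zeta> ^ i \<partial>M) =
      (if i \<le> m then moment M (m - i) else cnj (moment M (i - m)))" for i
  proof -
    have "(\<integral>\<zeta>. cnj \<zeta> ^ m * \<zeta> ^ i \<partial>M) =
        (\<integral>\<zeta>. (if i \<le> m then cnj \<zeta> ^ (m - i) else cnj (cnj \<zeta> ^ (i - m))) \<partial>M)"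
      by (rule Bochner_Integration.integral_cong) (use mono in auto)
    then show ?thesis
      using Bochner_Integration.integral_cnj[of M "\<lambda>\<zeta>. cnj \<zeta> ^ (i - m)"]
      unfolding moment_def by (cases "i \<le> m") simp_all
  qed
  have "(\<integral>\<zeta>. cnj \<zeta> ^ m * poly q \<zeta> \<partial>M) =
      (\<integral>\<zeta>. (\<Sum>i\<le>degree q. coeff q i * (cnj \<zeta> ^ m * \<zeta> ^ i)) \<partial>M)"
    by (simp add: poly_altdef sum_distrib_left mult_ac)
  also have "\<dots> = (\<Sum>i\<le>degree q. coeff q i * (\<integral>\<zeta>. cnj \<zeta> ^ m * \<zeta> ^ i \<partial>M))"
    by (subst Bochner_Integration.integral_sum)
      (auto intro!: integrable_continuous continuous_intros)
  finally show ?thesis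
    by (simp add: term_eq)
qed

text \<open>
  Three measures with a linear relation, rather than two equal ones, because arc length enters with a
  coefficient of either sign when measures of different total mass are compared.
\<close>

lemma moments_determine_integral:
  fixes f :: "complex \<Rightarrow> real"
  assumes "circle_measure M" "circle_measure N" "circle_measure P"
    and mom: "\<And>n. moment M n = moment N n + of_real r * moment P n"
    and f: "continuous_on (sphere 0 1) f"
  shows "(\<integral>\<zeta>. f \<zeta> \<partial>M) = (\<integral>\<zeta>. f \<zeta> \<partial>N) + r * (\<integral>\<zeta>. f \<zeta> \<partial>P)"
proof -
  interpret M: circle_measure M by fact
  interpret N: circle_measure N by fact
  interpret P: circle_measure P by fact
  define \<Delta> where "\<Delta> f = (\<integral>\<zeta>. f \<zeta> \<partial>M) - (\<integral>\<zeta>. f \<zeta> \<partial>N) - r * (\<integral>\<zeta>. f \<zeta> \<partial>P)" for f :: "complex \<Rightarrow> real"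
  have poly0: "\<Delta> p = 0" if p: "real_polynomial_function p" for p
  proof -
    obtain q m where q: "\<And>\<zeta>. \<zeta> \<in> sphere 0 1 \<Longrightarrow> complex_of_real (p \<zeta>) = cnj \<zeta> ^ m * poly q \<zeta>"
      using real_polynomial_function_circle[OF p] by blast
    have eq: "complex_of_real (\<integral>\<zeta>. p \<zeta> \<partial>X) = (\<integral>\<zeta>. cnj \<zeta> ^ m * poly q \<zeta> \<partial>X)"
      if "circle_measure X" for X
    proof -
      interpret X: circle_measure X by fact
      have "(\<integral>\<zeta>. cnj \<zeta> ^ m * poly q \<zeta> \<partial>X) = (\<integral>\<zeta>. complex_of_real (p \<zeta>) \<partial>X)"
        by (rule Bochner_Integration.integral_cong) (use q in auto)
      then show ?thesis by simp
    qed
    have "complex_of_real (\<Delta> p) = (\<integral>\<zeta>. cnj \<zeta> ^ m * poly q \<zeta> \<partial>M) -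
        (\<integral>\<zeta>. cnj \<zeta> ^ m * poly q \<zeta> \<partial>N) - of_real r * (\<integral>\<zeta>. cnj \<zeta> ^ m * poly q \<zeta> \<partial>P)"
      using assms(1-3) unfolding \<Delta>_def by (simp add: eq)
    also have "\<dots> = 0"
      unfolding M.integral_laurent N.integral_laurent P.integral_laurent
        sum_distrib_left sum_subtractf[symmetric]
      by (intro sum.neutral ballI) (simp add: mom algebra_simps)
    finally show ?thesis by simp
  qed
  define T where "T = measure M (sphere 0 1) + measure N (sphere 0 1) + \<bar>r\<bar> * measure P (sphere 0 1)"
  have "\<bar>\<Delta> f\<bar> \<le> T * e" if "e > 0" for e
  proof -
    obtain p where p: "real_polynomial_function p" "\<And>\<zeta>. \<zeta> \<in> sphere 0 1 \<Longrightarrow> \<bar>f \<zeta> - p \<zeta>\<bar> < e"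
      using Stone_Weierstrass_real_polynomial_function[OF _ f \<open>e > 0\<close>] by auto
    have pc: "continuous_on (sphere 0 1) p"
      using p(1) by (intro continuous_on_polymonial_function) (simp add: real_polynomial_function_eq)
    have bd: "\<bar>(\<integral>\<zeta>. f \<zeta> \<partial>X) - (\<integral>\<zeta>. p \<zeta> \<partial>X)\<bar> \<le> measure X (sphere 0 1) * e"
      if "circle_measure X" for X
    proof -
      interpret X: circle_measure X by fact
      have "\<bar>(\<integral>\<zeta>. f \<zeta> \<partial>X) - (\<integral>\<zeta>. p \<zeta> \<partial>X)\<bar> = \<bar>\<integral>\<zeta>. f \<zeta> - p \<zeta> \<partial>X\<bar>"
        using f pc by (subst Bochner_Integration.integral_diff) (auto intro: X.integrable_continuous)
      also have "\<dots> \<le> (\<integral>\<zeta>. \<bar>f \<zeta> - p \<zeta>\<bar> \<partial>X)"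
        by (rule integral_abs_bound)
      also have "\<dots> \<le> (\<integral>\<zeta>. e \<partial>X)"
        using f pc p(2) by (intro integral_mono X.integrable_continuous continuous_intros) (auto intro: less_imp_le)
      finally show ?thesis by simp
    qed
    have "\<bar>r * (\<integral>\<zeta>. f \<zeta> \<partial>P) - r * (\<integral>\<zeta>. p \<zeta> \<partial>P)\<bar> \<le> \<bar>r\<bar> * (measure P (sphere 0 1) * e)"
      using bd[OF assms(3)] by (simp add: abs_mult mult_left_mono flip: right_diff_distrib)
    moreover have "\<Delta> f = \<Delta> f - \<Delta> p" using poly0[OF p(1)] by simp
    ultimately show ?thesis
      using bd[OF assms(1)] bd[OF assms(2)] unfolding \<Delta>_def T_def by (simp add: algebra_simps)
  qed
  moreover have "T \<ge> 0" unfolding T_def by simp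
  ultimately have "\<bar>\<Delta> f\<bar> \<le> e" if "e > 0" for e
  proof -
    have "\<bar>\<Delta> f\<bar> \<le> T * (e / (T + 1))" by (rule \<open>\<And>e. e > 0 \<Longrightarrow> \<bar>\<Delta> f\<bar> \<le> T * e\<close>) (use that \<open>T \<ge> 0\<close> in auto)
    also have "\<dots> \<le> e" using that \<open>T \<ge> 0\<close> by (simp add: field_simps)
    finally show ?thesis .
  qed
  then have "\<bar>\<Delta> f\<bar> \<le> 0 + e" if "e > 0" for e using that by auto
  then have "\<bar>\<Delta> f\<bar> \<le> 0" by (rule field_le_epsilon)
  then show ?thesis unfolding \<Delta>_def by simp
qed

text \<open>
  Closed sets form an intersection-stable generator, and the indicator of a closed set \<open>C\<close> is the
  bounded pointwise limit of the continuous functions \<open>max 0 (1 - k * infdist \<zeta> C)\<close>. So the relation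
  passes from integrals of continuous functions to closed sets, and then to all Borel sets by
  Dynkin's argument.
\<close>

theorem moments_determine_measure:
  assumes "circle_measure M" "circle_measure N" "circle_measure P"
    and mom: "\<And>n. moment M n = moment N n + of_real r * moment P n"
    and G: "G \<in> sets circle"
  shows "measure M G = measure N G + r * measure P G"
proof -
  interpret M: circle_measure M by fact
  interpret N: circle_measure N by fact
  interpret P: circle_measure P by fact
  define \<C> where "\<C> = {C :: complex set. closed C \<and> C \<subseteq> sphere 0 1}"
  have closed_case: "measure M C = measure N C + r * measure P C" if C: "C \<in> \<C>" for C
  proof (cases "C = {}")
    case False
    have C': "closed C" "C \<subseteq> sphere 0 1" using C by (auto simp: \<C>_def)
    then have CS: "C \<in> sets circle" by (auto simp: sets_circle borel_closed)
    define f where "f k \<zeta> = max 0 (1 - real k * infdist \<zeta> C)" for k \<zeta>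
    have fc: "continuous_on (sphere 0 1) (f k)" for k
      unfolding f_def by (intro continuous_intros)
    have lim: "(\<lambda>k. f k \<zeta>) \<longlonglongrightarrow> indicat_real C \<zeta>" for \<zeta>
    proof (cases "\<zeta> \<in> C")
      case True
      then show ?thesis by (simp add: f_def infdist_zero)
    next
      case out: False
      then have pos: "infdist \<zeta> C > 0"
        using infdist_pos_not_in_closed[OF C'(1) False] by simp
      obtain k0 :: nat where k0: "1 / infdist \<zeta> C < k0"
        using reals_Archimedean2 by blast
      have "f k \<zeta> = 0" if "k \<ge> k0" for k
      proof -
        have "1 < real k0 * infdist \<zeta> C" using k0 pos by (simp add: field_simps)
        also have "\<dots> \<le> real k * infdist \<zeta> C" using that pos by (intro mult_right_mono) auto
        finally show ?thesis by (simp add: f_def)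
      qed
      then have "\<forall>\<^sub>F k in sequentially. f k \<zeta> = 0"
        by (auto simp: eventually_sequentially)
      then show ?thesis using out by (simp add: tendsto_eventually)
    qed
    have conv: "(\<lambda>k. \<integral>\<zeta>. f k \<zeta> \<partial>X) \<longlonglongrightarrow> measure X C" if "circle_measure X" for X
    proof -
      interpret X: circle_measure X by fact
      have "(\<lambda>k. \<integral>\<zeta>. f k \<zeta> \<partial>X) \<longlonglongrightarrow> (\<integral>\<zeta>. indicat_real C \<zeta> \<partial>X)"
      proof (rule integral_dominated_convergence[where w = "\<lambda>_. 1"])
        show "AE \<zeta> in X. norm (f k \<zeta>) \<le> 1" for k
          by (auto simp: f_def infdist_nonneg)
        show "f k \<in> borel_measurable X" for k using X.measurable_continuous[OF fc] .
      qed (use lim CS in auto)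
      then show ?thesis using C'(2) by (simp add: Int_absorb2)
    qed
    have "(\<lambda>k. (\<integral>\<zeta>. f k \<zeta> \<partial>N) + r * (\<integral>\<zeta>. f k \<zeta> \<partial>P)) \<longlonglongrightarrow> measure N C + r * measure P C"
      by (intro tendsto_intros conv assms)
    then have "(\<lambda>k. \<integral>\<zeta>. f k \<zeta> \<partial>M) \<longlonglongrightarrow> measure N C + r * measure P C"
      using moments_determine_integral[OF assms(1-4) fc] by simp
    then show ?thesis
      using conv[OF assms(1)] LIMSEQ_unique by blast
  qed simp
  have gen: "sets circle = sigma_sets (sphere 0 1) \<C>"
  proof -
    have "(sphere 0 1 :: complex set) \<in> sigma_sets UNIV (Collect closed)"
      by (rule sigma_sets.Basic) simp
    then have "(\<inter>) (sphere 0 1) ` sigma_sets UNIV (Collect closed) =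
        sigma_sets (sphere 0 1) ((\<inter>) (sphere 0 1 :: complex set) ` Collect closed)"
      by (rule sigma_sets_Int) simp
    moreover have "sets (borel :: complex measure) = sigma_sets UNIV (Collect closed)"
      by (simp add: borel_eq_closed)
    moreover have "(\<inter>) (sphere 0 1) ` Collect closed = \<C>"
    proof (intro equalityI subsetI)
      fix C assume "C \<in> \<C>"
      then have "C = sphere 0 1 \<inter> C" "C \<in> Collect closed" by (auto simp: \<C>_def)
      then show "C \<in> (\<inter>) (sphere 0 1) ` Collect closed" by (rule image_eqI)
    qed (auto simp: \<C>_def)
    ultimately show ?thesis
      unfolding circle_def sets_restrict_space by simp
  qed
  have "Int_stable \<C>" "\<C> \<subseteq> Pow (sphere 0 1)" by (auto simp: Int_stable_def \<C>_def)
  moreover have "G \<in> sigma_sets (sphere 0 1) \<C>" using G gen by simp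
  ultimately show ?thesis
  proof (induction rule: sigma_sets_induct_disjoint)
    case (compl A)
    have A: "A \<in> sets circle" using compl(1) gen by simp
    have S: "sphere 0 1 \<in> \<C>" by (simp add: \<C>_def)
    have diff: "measure X (sphere 0 1 - A) = measure X (sphere 0 1) - measure X A"
      if "circle_measure X" for X
    proof -
      interpret X: circle_measure X by fact
      show ?thesis using X.finite_measure_compl[of A] A by simp
    qed
    then show ?case
      using closed_case[OF S] compl(2)
      by (simp only: diff[OF assms(1)] diff[OF assms(2)] diff[OF assms(3)]) (simp add: algebra_simps)
  next
    case (union A)
    have A: "range A \<subseteq> sets circle" using union(2) gen by simp
    have sums: "(\<lambda>i. measure X (A i)) sums measure X (\<Union>i. A i)" if "circle_measure X" for X
    proof -
      interpret X: circle_measure X by fact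
      show ?thesis using X.finite_measure_UNION[of A] A union(1) by simp
    qed
    have "(\<lambda>i. measure N (A i) + r * measure P (A i)) sums
        (measure N (\<Union>i. A i) + r * measure P (\<Union>i. A i))"
      by (intro sums_add sums_mult sums assms)
    then show ?case
      using sums[OF assms(1)] union(3) sums_unique2 by simp
  qed (use closed_case in auto)
qed

section \<open>Herglotz integrals\<close>

definition herglotz :: "complex measure \<Rightarrow> complex \<Rightarrow> complex" where
  "herglotz M z = (\<integral>\<zeta>. (\<zeta> + z) / (\<zeta> - z) \<partial>M)"

lemma sing_inner_eq_exp_herglotz: "sing_inner M z = exp (- herglotz M z)"
  by (simp add: sing_inner_def herglotz_def)

lemma continuous_on_herglotz_kernel:
  fixes z :: complex
  shows "z \<in> ball 0 1 \<Longrightarrow> continuous_on (sphere 0 1) (\<lambda>\<zeta>. (\<zeta> + z) / (\<zeta> - z))"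
  by (auto intro!: continuous_intros)

text \<open>
  With \<open>w = cnj \<zeta> * z\<close> the kernel is \<open>(1 + w) / (1 - w) = 2 / (1 - w) - 1\<close>, a geometric series.
\<close>

lemma herglotz_kernel_sums:
  assumes "z \<in> ball 0 1" "\<zeta> \<in> sphere 0 1"
  shows "(\<lambda>n. (if n = 0 then 1 else 2) * (cnj \<zeta> * z) ^ n) sums ((\<zeta> + z) / (\<zeta> - z))"
proof -
  define w where "w = cnj \<zeta> * z"
  have w: "cmod w < 1" using assms by (simp add: w_def norm_mult)
  then have "1 - w \<noteq> 0" by auto
  have "(\<lambda>n. 2 * w ^ n - (if n = 0 then 1 else 0)) sums (2 * (1 / (1 - w)) - 1)"
    using w sums_single[of 0 "\<lambda>_. 1 :: complex"]
    by (intro sums_diff sums_mult geometric_sums) (auto simp: eq_commute)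
  moreover have "2 * w ^ n - (if n = 0 then 1 else 0) = (if n = 0 then 1 else 2) * w ^ n" for n
    by simp
  moreover have "2 * (1 / (1 - w)) - 1 = (\<zeta> + z) / (\<zeta> - z)"
  proof -
    have "\<zeta> + z = \<zeta> * (1 + w)" "\<zeta> - z = \<zeta> * (1 - w)"
      using cnj_eq_inverse_circle[OF assms(2)] by (simp_all add: w_def algebra_simps)
    moreover have "\<zeta> \<noteq> 0" using assms(2) by auto
    ultimately show ?thesis using \<open>1 - w \<noteq> 0\<close> by (simp add: field_simps)
  qed
  ultimately show ?thesis by (simp add: w_def)
qed

lemma (in circle_measure) herglotz_sums:
  assumes z: "z \<in> ball 0 1"
  shows "(\<lambda>n. (if n = 0 then 1 else 2) * moment M n * z ^ n) sums herglotz M z"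
proof -
  define f where "f n \<zeta> = (if n = 0 then 1 else 2) * (cnj \<zeta> * z) ^ n" for n :: nat and \<zeta>
  have int: "integrable M (f n)" for n
    unfolding f_def by (intro integrable_continuous continuous_intros)
  have norm_f: "norm (f n \<zeta>) = (if n = 0 then 1 else 2) * norm z ^ n" if "\<zeta> \<in> sphere 0 1" for n \<zeta>
    using that by (simp add: f_def norm_mult norm_power power_mult_distrib)
  have geo: "summable (\<lambda>n. (if n = 0 then 1 else 2) * norm z ^ n)"
    by (rule summable_comparison_test[OF _ summable_mult[OF summable_geometric[of "norm z"], of 2]])
      (use z in auto)
  have "(\<lambda>n. integral\<^sup>L M (f n)) sums (\<integral>\<zeta>. (\<Sum>n. f n \<zeta>) \<partial>M)"
  proof (rule sums_integral[OF int])
    show "AE \<zeta> in M. summable (\<lambda>n. norm (f n \<zeta>))"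
      using geo by (intro AE_I2) (simp add: norm_f)
    have "(\<integral>\<zeta>. norm (f n \<zeta>) \<partial>M) = (\<integral>\<zeta>. (if n = 0 then 1 else 2) * norm z ^ n \<partial>M)" for n
      by (rule Bochner_Integration.integral_cong) (auto simp: norm_f)
    then show "summable (\<lambda>n. \<integral>\<zeta>. norm (f n \<zeta>) \<partial>M)"
      using summable_mult[OF geo, of "measure M (sphere 0 1)"] by (simp add: mult.assoc)
  qed
  moreover have "integral\<^sup>L M (f n) = (if n = 0 then 1 else 2) * moment M n * z ^ n" for n
    unfolding f_def moment_def by (simp add: power_mult_distrib)
  moreover have "(\<integral>\<zeta>. (\<Sum>n. f n \<zeta>) \<partial>M) = herglotz M z"
    unfolding herglotz_def f_def
    by (rule Bochner_Integration.integral_cong[OF refl], rule sums_unique[symmetric],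
        rule herglotz_kernel_sums) (use z in auto)
  ultimately show ?thesis by simp
qed

lemma (in circle_measure) moment_0: "moment M 0 = of_real (measure M (sphere 0 1))"
  by (simp add: moment_def scaleR_conv_of_real)

lemma (in circle_measure) herglotz_holomorphic: "herglotz M holomorphic_on ball 0 1"
proof (rule power_series_holomorphic)
  show "(\<lambda>n. ((if n = 0 then 1 else 2) * moment M n) * (z - 0) ^ n) sums herglotz M z"
    if "z \<in> ball 0 1" for z
    using herglotz_sums[OF that] by simp
qed

text \<open>
  The constant \<open>\<kappa>\<close> only affects the Taylor coefficient of index \<open>0\<close>.
\<close>

lemma herglotz_determines_moments:
  assumes "circle_measure M" "circle_measure N"
    and eq: "\<And>z. z \<in> ball 0 1 \<Longrightarrow> herglotz M z = herglotz N z + \<kappa>"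
    and n: "n > 0"
  shows "moment M n = moment N n"
proof (rule ccontr)
  interpret M: circle_measure M by fact
  interpret N: circle_measure N by fact
  define c where "c n = (if n = 0 then 1 else 2) * (moment M n - moment N n) - (if n = 0 then \<kappa> else 0)" for n :: nat
  assume "moment M n \<noteq> moment N n"
  then have c: "c n \<noteq> 0" using n by (simp add: c_def)
  have "(\<lambda>n. c n * (z - 0) ^ n) sums 0" if "norm (z - 0) < 1" for z
  proof -
    have z: "z \<in> ball 0 1" using that by simp
    have "(\<lambda>n. (if n = 0 then 1 else 2) * moment M n * z ^ n - (if n = 0 then 1 else 2) * moment N n * z ^ n
          - (if n = 0 then \<kappa> else 0)) sums (herglotz M z - herglotz N z - \<kappa>)"
      using sums_single[of 0 "\<lambda>_. \<kappa>"]
      by (intro sums_diff M.herglotz_sums N.herglotz_sums z) (auto simp: eq_commute)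
    moreover have "(if n = 0 then 1 else 2) * moment M n * z ^ n - (if n = 0 then 1 else 2) * moment N n * z ^ n
          - (if n = 0 then \<kappa> else 0) = c n * (z - 0) ^ n" for n
      by (simp add: c_def algebra_simps)
    ultimately show ?thesis using eq[OF z] by simp
  qed
  then show False
  proof (rule powser_0_nonzero[where \<xi> = 0 and r = 1 and a = c and f = "\<lambda>_. 0" and m = n, rotated])
    fix s :: real
    assume "0 < s" and nz: "\<And>z :: complex. z \<in> cball 0 s - {0} \<Longrightarrow> (0 :: complex) \<noteq> 0"
    then have "complex_of_real s \<in> cball 0 s - {0}" by simp
    then show False using nz by blast
  qed (use c n in auto)
qed

lemma emeasure_arc_length:
  assumes "G \<in> sets circle"
  shows "emeasure arc_length G = emeasure lborel (cis -` G \<inter> {0..<2*pi})"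
proof -
  have "emeasure arc_length G = emeasure (restrict_space lborel {0..<2*pi}) (cis -` G \<inter> {0..<2*pi})"
    unfolding arc_length_def using assms
    by (subst emeasure_distr[OF cis_measurable]) (auto simp: space_restrict_space)
  also have "\<dots> = emeasure lborel (cis -` G \<inter> {0..<2*pi})"
    by (subst emeasure_restrict_space) auto
  finally show ?thesis .
qed

lemma sphere_in_sets_circle [simp]: "sphere 0 1 \<in> sets circle"
  using sets.top[of circle] by simp

lemma emeasure_arc_length_sphere: "emeasure arc_length (sphere 0 1) = ennreal (2 * pi)"
proof -
  have "cis -` sphere 0 1 \<inter> {0..<2*pi} = {0..<2*pi}" by auto
  then show ?thesis by (simp add: emeasure_arc_length)
qed

lemma circle_measure_arc_length: "circle_measure arc_length"
proof (intro circle_measure.intro circle_measure_axioms.intro finite_measureI)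
  show sets: "sets arc_length = sets circle" by (simp add: arc_length_def)
  show "emeasure arc_length (space arc_length) \<noteq> \<infinity>"
    using emeasure_arc_length_sphere sets_eq_imp_space_eq[OF sets] by simp
qed

lemma measure_arc_length_sphere: "measure arc_length (sphere 0 1) = 2 * pi"
  by (simp add: measure_def emeasure_arc_length_sphere)

lemma arc_length_one: "emeasure arc_length {1} = 0"
proof -
  have "cis -` {1} \<inter> {0..<2*pi} \<subseteq> {0}"
  proof
    fix \<theta> assume "\<theta> \<in> cis -` {1} \<inter> {0..<2*pi}"
    then have \<theta>: "cos \<theta> = 1" "0 \<le> \<theta>" "\<theta> < 2 * pi" by (auto simp: cis.ctr complex_eq_iff)
    then obtain n :: int where n: "\<theta> = real_of_int n * 2 * pi" by (auto simp: cos_one_2pi_int)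
    then have "0 \<le> real_of_int n" "real_of_int n < 1"
      using \<theta> pi_gt_zero by (auto simp: zero_le_mult_iff)
    then show "\<theta> \<in> {0}" using n by simp
  qed
  then have "emeasure lborel (cis -` {1} \<inter> {0..<2*pi}) \<le> emeasure lborel {0::real}"
    by (rule emeasure_mono) simp
  then show ?thesis by (subst emeasure_arc_length) (auto simp: sets_circle)
qed

lemma moment_arc_length:
  assumes "n > 0"
  shows "moment arc_length n = 0"
proof -
  interpret circle_measure arc_length by (rule circle_measure_arc_length)
  define F where "F \<theta> = cis (- real n * \<theta>) / (- \<i> * real n)" for \<theta>
  have cis_pow: "cnj (cis \<theta>) ^ n = cis (- real n * \<theta>)" for \<theta>
    unfolding cis_cnj Complex.DeMoivre by simp
  have "moment arc_length n = (\<integral>\<theta>. cis (- real n * \<theta>) \<partial>restrict_space lborel {0..<2*pi})"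
    unfolding moment_def unfolding arc_length_def
    by (subst integral_distr[OF cis_measurable])
      (auto simp: cis_pow circle_def intro!: borel_measurable_continuous_on_restrict continuous_intros)
  also have "\<dots> = (\<integral>\<theta>. indicator {0..<2*pi} \<theta> *\<^sub>R cis (- real n * \<theta>) \<partial>lborel)"
    by (subst integral_restrict_space) auto
  also have "\<dots> = (\<integral>\<theta>. indicator {0..2*pi} \<theta> *\<^sub>R cis (- real n * \<theta>) \<partial>lborel)"
  proof (rule integral_cong_AE)
    show "AE \<theta> in lborel. indicator {0..<2*pi} \<theta> *\<^sub>R cis (- real n * \<theta>) =
        indicator {0..2*pi} \<theta> *\<^sub>R cis (- real n * \<theta>)"
      using AE_lborel_singleton[of "2*pi"] by eventually_elim (auto simp: indicator_def)
    have [measurable]: "(\<lambda>\<theta>. cis (- real n * \<theta>)) \<in> borel_measurable borel"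
      by (intro borel_measurable_continuous_onI continuous_intros)
    show "(\<lambda>\<theta>. indicator {0..<2*pi} \<theta> *\<^sub>R cis (- real n * \<theta>)) \<in> borel_measurable lborel"
      "(\<lambda>\<theta>. indicator {0..2*pi} \<theta> *\<^sub>R cis (- real n * \<theta>)) \<in> borel_measurable lborel"
      by measurable
  qed
  also have "\<dots> = F (2 * pi) - F 0"
  proof (rule integral_FTC_atLeastAtMost)
    show "(F has_vector_derivative cis (- real n * \<theta>)) (at \<theta> within {0..2*pi})" for \<theta>
      unfolding F_def cis_conv_exp using assms
      by (auto intro!: derivative_eq_intros has_vector_derivative_real_field simp: field_simps)
    show "continuous_on {0..2*pi} (\<lambda>\<theta>. cis (- real n * \<theta>))"
      by (intro continuous_intros)
  qed simp
  also have "F (2 * pi) = F 0"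
  proof -
    have "cis (- real n * (2 * pi)) = cnj (cis (2 * pi) ^ n)"
      unfolding Complex.DeMoivre cis_cnj by (simp add: mult_ac)
    then show ?thesis by (simp add: F_def)
  qed
  finally show ?thesis by simp
qed

text \<open>
  All moments of positive index of arc length vanish, so a suitable multiple of it makes up for the
  difference of the total masses without disturbing the other moments.
\<close>

theorem herglotz_determines_measure:
  assumes M: "circle_measure M" and N: "circle_measure N"
    and eq: "\<And>z. z \<in> ball 0 1 \<Longrightarrow> herglotz M z = herglotz N z + \<kappa>"
  shows "\<exists>r. \<forall>G\<in>sets circle. measure M G = measure N G + r * measure arc_length G"
proof -
  define r where "r = (measure M (sphere 0 1) - measure N (sphere 0 1)) / (2 * pi)"
  have "moment M n = moment N n + of_real r * moment arc_length n" for n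
  proof (cases "n = 0")
    case True
    have "complex_of_real (measure M (sphere 0 1)) =
        of_real (measure N (sphere 0 1) + r * measure arc_length (sphere 0 1))"
      unfolding measure_arc_length_sphere by (simp add: r_def)
    then show ?thesis
      using True M N circle_measure_arc_length by (simp add: circle_measure.moment_0)
  next
    case False
    then show ?thesis
      using herglotz_determines_moments[OF M N eq] by (simp add: moment_arc_length)
  qed
  then show ?thesis
    using moments_determine_measure[OF M N circle_measure_arc_length] by blast
qed

lemma singular_measure_circle: "singular_measure M \<Longrightarrow> circle_measure M"
  unfolding singular_measure_def circle_measure_def circle_measure_axioms_def by blast

text \<open>
  Outside a Lebesgue null set that carries both measures, both vanish while arc length has full
  mass, so the multiple of arc length in \<open>herglotz_determines_measure\<close> must be zero.
\<close>

theorem herglotz_determines_singular_measure: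
  assumes M: "singular_measure M" and N: "singular_measure N"
    and eq: "\<And>z. z \<in> ball 0 1 \<Longrightarrow> herglotz M z = herglotz N z + \<kappa>"
  shows "M = N"
proof -
  interpret M: circle_measure M by (rule singular_measure_circle[OF M])
  interpret N: circle_measure N by (rule singular_measure_circle[OF N])
  interpret L: circle_measure arc_length by (rule circle_measure_arc_length)
  obtain r where r: "\<And>G. G \<in> sets circle \<Longrightarrow> measure M G = measure N G + r * measure arc_length G"
    using herglotz_determines_measure[OF M.circle_measure_axioms N.circle_measure_axioms eq] by blast
  obtain A where A: "A \<in> sets circle" "emeasure arc_length A = 0" "emeasure M (sphere 0 1 - A) = 0"
    using M unfolding singular_measure_def by blast
  obtain B where B: "B \<in> sets circle" "emeasure arc_length B = 0" "emeasure N (sphere 0 1 - B) = 0"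
    using N unfolding singular_measure_def by blast
  define G where "G = sphere 0 1 - (A \<union> B)"
  have G: "G \<in> sets circle" using A(1) B(1) by (auto simp: G_def)
  have "emeasure M G \<le> emeasure M (sphere 0 1 - A)" "emeasure N G \<le> emeasure N (sphere 0 1 - B)"
    using A(1) B(1) by (intro emeasure_mono; auto simp: G_def)+
  then have "measure M G = 0" "measure N G = 0" using A(3) B(3) by (simp_all add: measure_def)
  moreover have "measure arc_length G = 2 * pi"
  proof -
    have "A \<union> B \<in> null_sets arc_length"
      using A B by (intro null_sets.Un) (auto simp: null_sets_def)
    then have "emeasure arc_length G = emeasure arc_length (sphere 0 1)"
      unfolding G_def by (intro emeasure_Diff_null_set) auto
    then show ?thesis by (simp add: measure_def emeasure_arc_length_sphere)
  qed
  ultimately have "r = 0" using r[OF G] by simp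
  then show ?thesis
    using r by (intro measure_eqI) (auto simp: M.emeasure_eq_measure N.emeasure_eq_measure)
qed

section \<open>Disc automorphisms and their action on measures\<close>

text \<open>
  Every automorphism of the disc has this form with \<open>cmod b < cmod a\<close>. The representation by the
  pair \<open>(a, b)\<close>, up to real factors, turns composition into a product of matrices.
\<close>

definition mob :: "complex \<Rightarrow> complex \<Rightarrow> complex \<Rightarrow> complex" where
  "mob a b z = (a * z + b) / (cnj b * z + cnj a)"

text \<open>
  The modulus of the derivative of \<open>mob a b\<close> on the closed disc if \<open>cmod b < cmod a\<close>; see \<open>has_field_derivative_mob\<close> and
  \<open>cmod_deriv_mob\<close>.
\<close>

definition jac :: "complex \<Rightarrow> complex \<Rightarrow> complex \<Rightarrow> real" where
  "jac a b \<zeta> = ((cmod a)\<^sup>2 - (cmod b)\<^sup>2) / (cmod (cnj b * \<zeta> + cnj a))\<^sup>2"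

definition push :: "complex \<Rightarrow> complex \<Rightarrow> complex measure \<Rightarrow> complex measure" where
  "push a b M = distr (density M (\<lambda>\<zeta>. ennreal (jac a b \<zeta>))) circle (mob a b)"

lemma sets_push [simp, measurable_cong]: "sets (push a b M) = sets circle"
  by (simp add: push_def)

lemma det_complex: "of_real ((cmod a)\<^sup>2 - (cmod b)\<^sup>2) = a * cnj a - b * cnj b"
  by (simp only: of_real_diff complex_norm_square)

locale disc_aut =
  fixes a b :: complex
  assumes norm_less: "cmod b < cmod a"
begin

lemma denom_nonzero: "cnj b * z + cnj a \<noteq> 0" if "cmod z \<le> 1"
proof
  assume "cnj b * z + cnj a = 0"
  then have "cmod (cnj a) = cmod (cnj b * z)"
    by (metis add_eq_0_iff norm_minus_cancel)
  also have "\<dots> \<le> cmod b" using that by (simp add: norm_mult mult_left_le)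
  finally show False using norm_less by simp
qed

lemma det_pos: "(cmod a)\<^sup>2 - (cmod b)\<^sup>2 > 0"
  using norm_less by (simp add: power_strict_mono)

lemma jac_pos: "jac a b z > 0" if "cmod z \<le> 1"
  using denom_nonzero[OF that] det_pos by (simp add: jac_def)

lemma numer_circle: "a * \<zeta> + b = \<zeta> * cnj (cnj b * \<zeta> + cnj a)" if "\<zeta> \<in> sphere 0 1"
proof -
  have "\<zeta> * cnj (cnj b * \<zeta> + cnj a) = (\<zeta> * cnj \<zeta>) * b + a * \<zeta>" by (simp add: algebra_simps)
  then show ?thesis using cnj_eq_inverse_circle[OF that] by simp
qed

lemma mob_sphere: "mob a b \<zeta> \<in> sphere 0 1" if "\<zeta> \<in> sphere 0 1"
proof -
  have "cmod (cnj b * \<zeta> + cnj a) \<noteq> 0" using denom_nonzero[of \<zeta>] that by simp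
  then show ?thesis
    using that unfolding mob_def numer_circle[OF that] by (simp add: norm_divide norm_mult del: complex_cnj_add)
qed

lemma mob_ball: "mob a b z \<in> ball 0 1" if "z \<in> ball 0 1"
proof -
  define n d where "n = a * z + b" and "d = cnj b * z + cnj a"
  have "d \<noteq> 0" using denom_nonzero[of z] that by (simp add: d_def)
  have "complex_of_real ((cmod d)\<^sup>2 - (cmod n)\<^sup>2) =
      of_real (((cmod a)\<^sup>2 - (cmod b)\<^sup>2) * (1 - (cmod z)\<^sup>2))"
    unfolding of_real_mult of_real_diff of_real_1 complex_norm_square
    by (simp add: n_def d_def algebra_simps)
  then have "(cmod d)\<^sup>2 - (cmod n)\<^sup>2 = ((cmod a)\<^sup>2 - (cmod b)\<^sup>2) * (1 - (cmod z)\<^sup>2)"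
    by (simp only: of_real_eq_iff)
  also have "\<dots> > 0" using det_pos that by (simp add: abs_square_less_1)
  finally have "cmod n < cmod d" by (simp add: power_less_imp_less_base)
  then show ?thesis
    using \<open>d \<noteq> 0\<close> by (simp add: mob_def norm_divide flip: n_def d_def)
qed

lemma has_field_derivative_mob:
  assumes "cmod z \<le> 1"
  shows "(mob a b has_field_derivative
    (of_real ((cmod a)\<^sup>2 - (cmod b)\<^sup>2) / (cnj b * z + cnj a)\<^sup>2)) (at z)"
  unfolding mob_def det_complex using denom_nonzero[OF assms]
  by (auto intro!: derivative_eq_intros simp: field_simps power2_eq_square)

lemma cmod_deriv_mob: "cmod (of_real ((cmod a)\<^sup>2 - (cmod b)\<^sup>2) / (cnj b * z + cnj a)\<^sup>2) = jac a b z"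
  unfolding norm_divide norm_of_real norm_power jac_def abs_of_pos[OF det_pos] ..

lemma continuous_on_mob: "continuous_on (sphere 0 1) (mob a b)"
  unfolding mob_def using denom_nonzero by (intro continuous_intros) auto

lemma continuous_on_jac: "continuous_on (sphere 0 1) (jac a b)"
  unfolding jac_def using denom_nonzero by (intro continuous_intros) auto

lemma holomorphic_mob: "mob a b holomorphic_on ball 0 1"
  unfolding mob_def using denom_nonzero by (intro holomorphic_intros) auto

lemma measurable_mob [measurable]: "mob a b \<in> measurable circle circle"
proof -
  have "mob a b \<in> borel_measurable circle"
    unfolding circle_def by (rule borel_measurable_continuous_on_restrict[OF continuous_on_mob])
  then show ?thesis
    using mob_sphere unfolding circle_def
    by (intro measurable_restrict_space2) (auto simp: space_restrict_space)
qed

lemma measurable_jac [measurable]: "jac a b \<in> borel_measurable circle"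
  unfolding circle_def by (rule borel_measurable_continuous_on_restrict[OF continuous_on_jac])

lemma nn_integral_push:
  assumes [measurable_cong, simp]: "sets M = sets circle" and [measurable]: "f \<in> borel_measurable circle"
  shows "(\<integral>\<^sup>+ \<zeta>. f \<zeta> \<partial>push a b M) = (\<integral>\<^sup>+ \<zeta>. ennreal (jac a b \<zeta>) * f (mob a b \<zeta>) \<partial>M)"
  unfolding push_def
  by (subst nn_integral_distr) (auto simp: nn_integral_density)

lemma emeasure_push:
  assumes "sets M = sets circle" "G \<in> sets circle"
  shows "emeasure (push a b M) G = (\<integral>\<^sup>+ \<zeta>. ennreal (jac a b \<zeta>) * indicator G (mob a b \<zeta>) \<partial>M)"
  using nn_integral_push[OF assms(1), of "indicator G"] assms(2) by simp

lemma circle_measure_push: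
  assumes "circle_measure M"
  shows "circle_measure (push a b M)"
proof (intro circle_measure.intro circle_measure_axioms.intro finite_measureI)
  interpret circle_measure M by fact
  have sp: "space (push a b M) = sphere 0 1" by (simp add: push_def)
  have "emeasure (push a b M) (sphere 0 1) =
      (\<integral>\<^sup>+ \<zeta>. ennreal (jac a b \<zeta>) * indicator (sphere 0 1) (mob a b \<zeta>) \<partial>M)"
    by (rule emeasure_push) auto
  also have "\<dots> \<le> (\<integral>\<^sup>+ \<zeta>. ennreal (norm (jac a b \<zeta>)) \<partial>M)"
    by (intro nn_integral_mono) (auto simp: indicator_def ennreal_leI)
  also have "\<dots> < \<infinity>"
    using integrable_continuous[OF continuous_on_jac] by (simp add: integrable_iff_bounded)
  finally show "emeasure (push a b M) (space (push a b M)) \<noteq> \<infinity>" by (simp add: sp)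
qed simp

lemma integral_push:
  fixes f :: "complex \<Rightarrow> complex"
  assumes "circle_measure M" and f[measurable]: "f \<in> borel_measurable circle"
  shows "(\<integral>\<zeta>. f \<zeta> \<partial>push a b M) = (\<integral>\<zeta>. of_real (jac a b \<zeta>) * f (mob a b \<zeta>) \<partial>M)"
proof -
  interpret circle_measure M by fact
  have "(\<integral>\<zeta>. f \<zeta> \<partial>push a b M) = (\<integral>\<zeta>. f (mob a b \<zeta>) \<partial>density M (\<lambda>\<zeta>. ennreal (jac a b \<zeta>)))"
    unfolding push_def by (rule integral_distr) measurable
  also have "\<dots> = (\<integral>\<zeta>. jac a b \<zeta> *\<^sub>R f (mob a b \<zeta>) \<partial>M)"
    using jac_pos by (intro integral_density) (auto intro!: AE_I2 less_imp_le)
  finally show ?thesis by (simp add: scaleR_conv_of_real)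
qed

text \<open>
  The correction term in \<open>herglotz_kernel_mob\<close>, which is independent of \<open>z\<close> and, on the circle, purely
  imaginary.
\<close>

definition drift :: "complex \<Rightarrow> complex" where
  "drift \<zeta> = 1 - 2 * \<zeta> * cnj b / (cnj b * \<zeta> + cnj a) - of_real (jac a b \<zeta>)"

lemma jac_complex: "of_real (jac a b \<zeta>) =
    (a * cnj a - b * cnj b) / ((cnj b * \<zeta> + cnj a) * cnj (cnj b * \<zeta> + cnj a))"
  unfolding jac_def of_real_divide det_complex complex_norm_square ..

lemma Re_drift: "Re (drift \<zeta>) = 0" if \<zeta>: "\<zeta> \<in> sphere 0 1"
proof -
  define d where "d = cnj b * \<zeta> + cnj a"
  have "d \<noteq> 0" using denom_nonzero[of \<zeta>] \<zeta> by (auto simp: d_def)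
  then have d: "d \<noteq> 0" "cnj d \<noteq> 0" by simp_all
  have p: "a * \<zeta> + b = \<zeta> * cnj d" using numer_circle[OF \<zeta>] by (simp add: d_def)
  have "(drift \<zeta> + cnj (drift \<zeta>)) * (d * cnj d) =
      2 * (d * cnj d) - 2 * cnj b * (\<zeta> * cnj d) - cnj (2 * cnj b * (\<zeta> * cnj d)) - 2 * (a * cnj a - b * cnj b)"
    using d unfolding drift_def jac_complex d_def[symmetric]
    by (simp add: field_simps)
  also have "\<dots> = 2 * (cnj (\<zeta> * cnj d) * (\<zeta> * cnj d)) - 2 * cnj b * (\<zeta> * cnj d) - cnj (2 * cnj b * (\<zeta> * cnj d)) - 2 * (a * cnj a - b * cnj b)"
    using cnj_eq_inverse_circle[OF \<zeta>] by (simp add: mult_ac)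
  also have "\<dots> = 2 * a * cnj a * (\<zeta> * cnj \<zeta>) - 2 * a * cnj a"
    unfolding p[symmetric] by (simp add: algebra_simps)
  also have "\<dots> = 0" using cnj_eq_inverse_circle[OF \<zeta>] by simp
  finally have "drift \<zeta> + cnj (drift \<zeta>) = 0" using d by simp
  then show ?thesis by (simp add: complex_eq_iff)
qed

text \<open>
  The kernel at \<open>(mob \<zeta>, mob z)\<close> has a simple pole at \<open>z = \<zeta>\<close> like the kernel at \<open>(\<zeta>, z)\<close>, and the factor
  \<open>\<bar>mob' \<zeta>\<bar>\<close> makes the residues agree; the difference is a rational function of \<open>z\<close> without poles, also at
  infinity, hence a constant. Its real part vanishes because the real part of the kernel is the Poisson
  kernel, which is conformally invariant.
\<close>

lemma herglotz_kernel_mob: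
  assumes \<zeta>: "\<zeta> \<in> sphere 0 1" and z: "z \<in> ball 0 1"
  shows "of_real (jac a b \<zeta>) * ((mob a b \<zeta> + mob a b z) / (mob a b \<zeta> - mob a b z)) =
    (\<zeta> + z) / (\<zeta> - z) + drift \<zeta>"
proof -
  define d e p q where "d = cnj b * \<zeta> + cnj a" and "e = cnj b * z + cnj a"
    and "p = a * \<zeta> + b" and "q = a * z + b"
  define D where "D = a * cnj a - b * cnj b"
  have "d \<noteq> 0" "e \<noteq> 0"
    using denom_nonzero[of \<zeta>] denom_nonzero[of z] \<zeta> z by (auto simp: d_def e_def)
  then have d: "d \<noteq> 0" "cnj d \<noteq> 0" "e \<noteq> 0" by simp_all
  have D: "D \<noteq> 0" using det_pos det_complex[of a b] unfolding D_def by (metis of_real_eq_0_iff less_irrefl)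
  have nz: "\<zeta> - z \<noteq> 0" using \<zeta> z by auto
  have pd: "p = \<zeta> * cnj d" using numer_circle[OF \<zeta>] by (simp add: d_def p_def)
  have det: "p * e - q * d = D * (\<zeta> - z)"
    by (simp add: p_def e_def q_def d_def D_def algebra_simps)
  \<comment> \<open>replaces the last dependence on \<open>z\<close> in the numerator by a multiple of \<open>\<zeta> - z\<close>\<close>
  have de: "d - e = cnj b * (\<zeta> - z)" by (simp add: d_def e_def algebra_simps)
  have "(mob a b \<zeta> + mob a b z) / (mob a b \<zeta> - mob a b z) = (p * e + q * d) / (p * e - q * d)"
    unfolding mob_def d_def[symmetric] e_def[symmetric] p_def[symmetric] q_def[symmetric]
    using d by (simp add: add_frac_eq diff_frac_eq)
  also have "\<dots> = (p * e + q * d) / (D * (\<zeta> - z))" unfolding det ..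
  finally have "of_real (jac a b \<zeta>) * ((mob a b \<zeta> + mob a b z) / (mob a b \<zeta> - mob a b z)) =
      (p * e + q * d) / (d * cnj d * (\<zeta> - z))"
    unfolding jac_complex d_def[symmetric] D_def[symmetric] using D by simp
  also have "p * e + q * d = 2 * p * e - D * (\<zeta> - z)"
    unfolding det[symmetric] by simp
  also have "\<dots> = 2 * p * d - 2 * p * cnj b * (\<zeta> - z) - D * (\<zeta> - z)"
  proof -
    have "e = d - cnj b * (\<zeta> - z)" using de by (simp add: algebra_simps)
    then show ?thesis by (simp only:) (simp add: algebra_simps)
  qed
  also have "\<dots> / (d * cnj d * (\<zeta> - z)) = 2 * \<zeta> / (\<zeta> - z) - 2 * \<zeta> * cnj b / d - D / (d * cnj d)"
    unfolding pd using d nz by (simp add: diff_divide_distrib)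
  also have "\<dots> = (\<zeta> + z) / (\<zeta> - z) + drift \<zeta>"
    unfolding drift_def jac_complex d_def[symmetric] D_def[symmetric]
    using nz by (simp add: field_simps)
  finally show ?thesis .
qed

lemma continuous_on_drift: "continuous_on (sphere 0 1) drift"
  unfolding drift_def using denom_nonzero
  by (intro continuous_intros continuous_on_jac) auto

lemma herglotz_push:
  assumes "circle_measure M"
  shows "\<exists>\<kappa>. Re \<kappa> = 0 \<and> (\<forall>z\<in>ball 0 1. herglotz (push a b M) (mob a b z) = herglotz M z + \<kappa>)"
proof (intro exI conjI ballI)
  interpret circle_measure M by fact
  have "Re (\<integral>\<zeta>. drift \<zeta> \<partial>M) = (\<integral>\<zeta>. Re (drift \<zeta>) \<partial>M)"
    using integrable_continuous[OF continuous_on_drift] by (rule integral_Re[symmetric])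
  also have "\<dots> = (\<integral>\<zeta>. 0 \<partial>M)"
    by (rule Bochner_Integration.integral_cong) (auto simp: Re_drift)
  finally show "Re (\<integral>\<zeta>. drift \<zeta> \<partial>M) = 0" by simp
  fix z :: complex assume z: "z \<in> ball 0 1"
  have "(\<lambda>\<zeta>. (\<zeta> + mob a b z) / (\<zeta> - mob a b z)) \<in> borel_measurable circle"
    unfolding circle_def
    by (intro borel_measurable_continuous_on_restrict continuous_on_herglotz_kernel mob_ball z)
  then have "herglotz (push a b M) (mob a b z) =
      (\<integral>\<zeta>. of_real (jac a b \<zeta>) * ((mob a b \<zeta> + mob a b z) / (mob a b \<zeta> - mob a b z)) \<partial>M)"
    unfolding herglotz_def by (intro integral_push assms)
  also have "\<dots> = (\<integral>\<zeta>. (\<zeta> + z) / (\<zeta> - z) + drift \<zeta> \<partial>M)"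
    using z by (intro Bochner_Integration.integral_cong herglotz_kernel_mob) auto
  also have "\<dots> = herglotz M z + (\<integral>\<zeta>. drift \<zeta> \<partial>M)"
    unfolding herglotz_def
    by (intro Bochner_Integration.integral_add integrable_continuous continuous_on_drift
        continuous_on_herglotz_kernel z)
  finally show "herglotz (push a b M) (mob a b z) = herglotz M z + (\<integral>\<zeta>. drift \<zeta> \<partial>M)" .
qed

lemma invariant_imp_eigen:
  assumes "circle_measure M" "push a b M = M"
  shows "\<exists>\<gamma>. cmod \<gamma> = 1 \<and> (\<forall>z\<in>ball 0 1. sing_inner M (mob a b z) = \<gamma> * sing_inner M z)"
proof -
  obtain \<kappa> where \<kappa>: "Re \<kappa> = 0" "\<And>z. z \<in> ball 0 1 \<Longrightarrow> herglotz M (mob a b z) = herglotz M z + \<kappa>"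
    using herglotz_push[OF assms(1)] assms(2) by auto
  have "cmod (exp (- \<kappa>)) = 1" using \<kappa>(1) by simp
  moreover have "sing_inner M (mob a b z) = exp (- \<kappa>) * sing_inner M z" if "z \<in> ball 0 1" for z
    using \<kappa>(2)[OF that] by (simp add: sing_inner_eq_exp_herglotz exp_diff exp_minus field_simps)
  ultimately show ?thesis by blast
qed

end

lemma mob_mob:
  assumes "disc_aut a b" "disc_aut c d" "cmod z \<le> 1"
  shows "mob a b (mob c d z) = mob (a * c + b * cnj d) (a * d + b * cnj c) z"
    and "jac a b (mob c d z) * jac c d z = jac (a * c + b * cnj d) (a * d + b * cnj c) z"
proof -
  define n e where "n = c * z + d" and "e = cnj d * z + cnj c"
  have e: "e \<noteq> 0" using disc_aut.denom_nonzero[OF assms(2,3)] by (simp add: e_def)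
  have m: "mob c d z = n / e" by (simp add: mob_def n_def e_def)
  have den: "cnj b * mob c d z + cnj a = (cnj (a * d + b * cnj c) * z + cnj (a * c + b * cnj d)) / e"
    unfolding m using e by (simp add: field_simps) (simp add: n_def e_def algebra_simps)
  have num: "a * mob c d z + b = ((a * c + b * cnj d) * z + (a * d + b * cnj c)) / e"
    unfolding m using e by (simp add: field_simps) (simp add: n_def e_def algebra_simps)
  show "mob a b (mob c d z) = mob (a * c + b * cnj d) (a * d + b * cnj c) z"
    unfolding mob_def[of a b] mob_def[of "a * c + b * cnj d"] den num using e by simp
  have "complex_of_real (((cmod a)\<^sup>2 - (cmod b)\<^sup>2) * ((cmod c)\<^sup>2 - (cmod d)\<^sup>2)) =
      of_real ((cmod (a * c + b * cnj d))\<^sup>2 - (cmod (a * d + b * cnj c))\<^sup>2)"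
    unfolding of_real_mult det_complex by (simp add: algebra_simps)
  then have "((cmod a)\<^sup>2 - (cmod b)\<^sup>2) * ((cmod c)\<^sup>2 - (cmod d)\<^sup>2) =
      (cmod (a * c + b * cnj d))\<^sup>2 - (cmod (a * d + b * cnj c))\<^sup>2"
    by (simp only: of_real_eq_iff)
  then show "jac a b (mob c d z) * jac c d z = jac (a * c + b * cnj d) (a * d + b * cnj c) z"
    unfolding jac_def[of a b] jac_def[of "a * c + b * cnj d"] den e_def[symmetric] jac_def[of c d]
    using e by (simp add: norm_divide power_divide)
qed

lemma mob_double: "mob (2 * a) (2 * b) z = mob a b z" "jac (2 * a) (2 * b) z = jac a b z"
proof -
  have *: "cnj (2 * b) * z + cnj (2 * a) = 2 * (cnj b * z + cnj a)" "2 * a * z + 2 * b = 2 * (a * z + b)"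
    by (simp_all add: algebra_simps)
  show "mob (2 * a) (2 * b) z = mob a b z"
    unfolding mob_def * by (rule mult_divide_mult_cancel_left) simp
  show "jac (2 * a) (2 * b) z = jac a b z"
    unfolding jac_def * norm_mult power_mult_distrib norm_numeral right_diff_distrib[symmetric]
    by (rule mult_divide_mult_cancel_left) simp
qed

context disc_aut
begin

lemma disc_aut_inverse: "disc_aut (cnj a) (- b)"
  by unfold_locales (use norm_less in simp)

text \<open>
  The matrices of an automorphism and of its inverse multiply to the determinant times the identity.
\<close>

lemma inverse_scalar: "mob (cnj a * a + - b * cnj b) (cnj a * b + - b * cnj a) z = z"
  "jac (cnj a * a + - b * cnj b) (cnj a * b + - b * cnj a) z = 1"
proof -
  define \<Delta> where "\<Delta> = (cmod a)\<^sup>2 - (cmod b)\<^sup>2"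
  have "cnj a * a + - b * cnj b = of_real \<Delta>" "cnj a * b + - b * cnj a = 0"
    unfolding \<Delta>_def det_complex by simp_all
  moreover have "\<Delta> > 0" using det_pos by (simp add: \<Delta>_def)
  ultimately show "mob (cnj a * a + - b * cnj b) (cnj a * b + - b * cnj a) z = z"
    "jac (cnj a * a + - b * cnj b) (cnj a * b + - b * cnj a) z = 1"
    by (simp_all add: mob_def jac_def)
qed

lemma mob_inverse: "cmod z \<le> 1 \<Longrightarrow> mob (cnj a) (- b) (mob a b z) = z"
  using mob_mob(1)[OF disc_aut_inverse disc_aut_axioms] inverse_scalar(1) by simp

lemma mob_inverse': "cmod z \<le> 1 \<Longrightarrow> mob a b (mob (cnj a) (- b) z) = z"
  using disc_aut.mob_inverse[OF disc_aut_inverse] by simp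

lemma ball_eq_mob:
  assumes "w \<in> ball 0 1"
  obtains z where "z \<in> ball 0 1" "w = mob a b z"
  using that[of "mob (cnj a) (- b) w"] disc_aut.mob_ball[OF disc_aut_inverse assms]
    mob_inverse'[of w] assms by simp

end

lemma herglotz_arc_length:
  assumes "z \<in> ball 0 1"
  shows "herglotz arc_length z = 2 * pi"
proof -
  interpret circle_measure arc_length by (rule circle_measure_arc_length)
  have "(\<lambda>n. (if n = 0 then 1 else 2) * moment arc_length n * z ^ n) =
      (\<lambda>n. if n = 0 then complex_of_real (2 * pi) else 0)"
    by (auto simp: fun_eq_iff moment_arc_length moment_0 measure_arc_length_sphere)
  then have "(\<lambda>n. if n = 0 then complex_of_real (2 * pi) else 0) sums herglotz arc_length z"
    using herglotz_sums[OF assms] by simp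
  moreover have "(\<lambda>n. if n = 0 then complex_of_real (2 * pi) else 0) sums (2 * pi)"
    using sums_single[of 0 "\<lambda>_. complex_of_real (2 * pi)"] by (simp add: eq_commute)
  ultimately show ?thesis by (rule sums_unique2)
qed

context disc_aut
begin

text \<open>
  The Herglotz integral of arc length is constant, hence so is that of its image under \<open>push\<close>. By
  uniqueness that image is a multiple of arc length, so it vanishes on \<open>N\<close>; since the density \<open>jac\<close> is
  positive, the preimage of \<open>N\<close> must be a null set.
\<close>

lemma arc_length_preimage_null:
  assumes N: "N \<in> sets circle" "emeasure arc_length N = 0"
  shows "emeasure arc_length {\<zeta> \<in> sphere 0 1. mob a b \<zeta> \<in> N} = 0"
proof -
  interpret L: circle_measure arc_length by (rule circle_measure_arc_length)
  interpret P: circle_measure "push a b arc_length"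
    by (rule circle_measure_push[OF circle_measure_arc_length])
  obtain \<kappa> where \<kappa>: "\<And>z. z \<in> ball 0 1 \<Longrightarrow>
      herglotz (push a b arc_length) (mob a b z) = herglotz arc_length z + \<kappa>"
    using herglotz_push[OF circle_measure_arc_length] by blast
  have "herglotz (push a b arc_length) w = herglotz arc_length w + \<kappa>" if w: "w \<in> ball 0 1" for w
    using w
  proof (rule ball_eq_mob)
    fix z assume "z \<in> ball 0 1" "w = mob a b z"
    then show ?thesis using \<kappa>[of z] w by (simp add: herglotz_arc_length)
  qed
  from herglotz_determines_measure[OF P.circle_measure_axioms circle_measure_arc_length this]
  obtain r where "measure (push a b arc_length) N = measure arc_length N + r * measure arc_length N"
    using N(1) by blast
  also have "\<dots> = 0" using N(2) by (simp add: measure_def)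
  finally have "emeasure (push a b arc_length) N = 0"
    by (simp add: P.emeasure_eq_measure)
  then have "(\<integral>\<^sup>+ \<zeta>. ennreal (jac a b \<zeta>) * indicator N (mob a b \<zeta>) \<partial>arc_length) = 0"
    using emeasure_push[OF L.sets_M N(1)] by simp
  then have "AE \<zeta> in arc_length. ennreal (jac a b \<zeta>) * indicator N (mob a b \<zeta>) = 0"
    using N(1) by (subst (asm) nn_integral_0_iff_AE) auto
  moreover have "AE \<zeta> in arc_length. \<zeta> \<in> sphere 0 1" by (rule AE_I2) simp
  ultimately have "AE \<zeta> in arc_length. mob a b \<zeta> \<notin> N"
  proof eventually_elim
    case (elim \<zeta>)
    then show ?case using jac_pos[of \<zeta>] by (auto simp: indicator_def)
  qed
  moreover have "mob a b -` N \<inter> space arc_length \<in> sets arc_length"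
    using N(1) by (intro measurable_sets[of _ _ circle]) auto
  then have "{\<zeta> \<in> sphere 0 1. mob a b \<zeta> \<in> N} \<in> sets arc_length"
    by (rule back_subst[of "\<lambda>S. S \<in> sets arc_length"]) auto
  ultimately show ?thesis
    using AE_iff_measurable[of "{\<zeta> \<in> sphere 0 1. mob a b \<zeta> \<in> N}" arc_length "\<lambda>\<zeta>. mob a b \<zeta> \<notin> N"]
    by simp
qed

lemma emeasure_push_eq_0:
  assumes M: "sets M = sets circle" and A: "A \<in> sets circle" "emeasure M (sphere 0 1 - A) = 0"
    and G: "G \<in> sets circle" "\<And>\<zeta>. \<zeta> \<in> sphere 0 1 \<Longrightarrow> \<zeta> \<in> A \<Longrightarrow> mob a b \<zeta> \<notin> G"
  shows "emeasure (push a b M) G = 0"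
proof -
  have sp: "space M = sphere 0 1" using sets_eq_imp_space_eq[OF M] by simp
  have "AE \<zeta> in M. \<zeta> \<in> A"
  proof (rule AE_I)
    show "{\<zeta> \<in> space M. \<not> \<zeta> \<in> A} \<subseteq> sphere 0 1 - A" by (auto simp: sp)
    show "emeasure M (sphere 0 1 - A) = 0" by fact
    show "sphere 0 1 - A \<in> sets M" unfolding M using A(1) by (intro sets.Diff) simp_all
  qed
  moreover have "AE \<zeta> in M. \<zeta> \<in> sphere 0 1" by (rule AE_I2) (simp add: sp)
  ultimately have "AE \<zeta> in M. ennreal (jac a b \<zeta>) * indicator G (mob a b \<zeta>) = 0"
    by eventually_elim (use G(2) in auto)
  then have "(\<integral>\<^sup>+ \<zeta>. ennreal (jac a b \<zeta>) * indicator G (mob a b \<zeta>) \<partial>M) = (\<integral>\<^sup>+ \<zeta>. 0 \<partial>M)"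
    by (rule nn_integral_cong_AE)
  then show ?thesis using emeasure_push[OF M G(1)] by simp
qed

lemma singular_measure_push:
  assumes "singular_measure M"
  shows "singular_measure (push a b M)"
proof -
  interpret circle_measure M by (rule singular_measure_circle) fact
  interpret P: circle_measure "push a b M" by (rule circle_measure_push[OF circle_measure_axioms])
  interpret I: disc_aut "cnj a" "- b" by (rule disc_aut_inverse)
  obtain A where A: "A \<in> sets circle" "emeasure arc_length A = 0" "emeasure M (sphere 0 1 - A) = 0"
    using assms unfolding singular_measure_def by blast
  define B where "B = {\<zeta> \<in> sphere 0 1. mob (cnj a) (- b) \<zeta> \<in> A}"
  have "mob (cnj a) (- b) -` A \<inter> space circle \<in> sets circle"
    using A(1) by (intro measurable_sets[of _ _ circle]) auto
  also have "mob (cnj a) (- b) -` A \<inter> space circle = B" by (auto simp: B_def)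
  finally have B: "B \<in> sets circle" .
  have "emeasure (push a b M) (sphere 0 1 - B) = 0"
    using A(1,3) B mob_sphere mob_inverse by (intro emeasure_push_eq_0) (auto simp: B_def)
  moreover have "emeasure arc_length B = 0"
    unfolding B_def using A by (intro I.arc_length_preimage_null)
  ultimately show ?thesis
    unfolding singular_measure_def using B P.finite_measure_axioms by auto
qed

text \<open>
  The function \<open>exp (F\<^sub>M - F\<^sub>M \<circ> mob)\<close> is constant, so its holomorphic exponent has derivative zero;
  combined with \<open>herglotz_push\<close> this makes \<open>F\<^bsub>push M\<^esub> - F\<^sub>M\<close> constant. An eigenvalue off the unit
  circle would force \<open>push M\<close> and \<open>M\<close> to differ by a nonzero multiple of arc length, which
  singularity excludes.
\<close>

theorem eigen_imp_invariant:
  assumes M: "singular_measure M" and eig: "comp_eigenvector (mob a b) (sing_inner M)"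
  shows "push a b M = M"
proof -
  interpret circle_measure M by (rule singular_measure_circle[OF M])
  obtain \<gamma> where \<gamma>: "\<And>z. z \<in> ball 0 1 \<Longrightarrow> sing_inner M (mob a b z) = \<gamma> * sing_inner M z"
    using eig unfolding comp_eigenvector_def comp_op_def o_def by blast
  define g where "g z = herglotz M z - herglotz M (mob a b z)" for z
  have exp_g: "exp (g z) = \<gamma>" if "z \<in> ball 0 1" for z
    using \<gamma>[OF that] by (simp add: g_def sing_inner_eq_exp_herglotz exp_diff exp_minus field_simps)
  have "(herglotz M \<circ> mob a b) holomorphic_on ball 0 1"
    using herglotz_holomorphic holomorphic_mob mob_ball by (intro holomorphic_on_compose_gen) auto
  then have "g holomorphic_on ball 0 1"
    unfolding g_def using herglotz_holomorphic by (intro holomorphic_intros) (auto simp: o_def)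
  have "(g has_field_derivative 0) (at z within ball 0 1)" if z: "z \<in> ball 0 1" for z
  proof -
    obtain g' where g': "(g has_field_derivative g') (at z)"
      using \<open>g holomorphic_on ball 0 1\<close> z
      by (meson field_differentiable_def holomorphic_on_imp_differentiable_at open_ball)
    have "((\<lambda>z. exp (g z)) has_field_derivative exp (g z) * g') (at z)"
      using g' by (auto intro!: derivative_eq_intros)
    moreover have "((\<lambda>z. exp (g z)) has_field_derivative 0) (at z)"
    proof (rule has_field_derivative_transform_within_open[where S = "ball 0 1"])
      show "((\<lambda>_. \<gamma>) has_field_derivative 0) (at z)" by simp
    qed (use z exp_g in auto)
    ultimately have "exp (g z) * g' = 0" by (rule DERIV_unique)
    then show ?thesis using g' by (simp add: has_field_derivative_at_within)
  qed
  then obtain c where c: "\<And>z. z \<in> ball 0 1 \<Longrightarrow> g z = c"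
    using has_field_derivative_zero_constant[of "ball 0 1" g] by auto
  obtain \<kappa> where \<kappa>: "\<And>z. z \<in> ball 0 1 \<Longrightarrow>
      herglotz (push a b M) (mob a b z) = herglotz M z + \<kappa>"
    using herglotz_push[OF circle_measure_axioms] by blast
  show ?thesis
  proof (rule herglotz_determines_singular_measure[OF singular_measure_push[OF M] M])
    fix w :: complex assume "w \<in> ball 0 1"
    then show "herglotz (push a b M) w = herglotz M w + (c + \<kappa>)"
    proof (rule ball_eq_mob)
      fix z assume "z \<in> ball 0 1" "w = mob a b z"
      then show ?thesis using \<kappa>[of z] c[of z] by (auto simp: g_def algebra_simps)
    qed
  qed
qed

end

section \<open>Sums of translates under a cyclic group of automorphisms\<close>

text \<open>
  A sum of measures is given here only through its values on sets, since the generated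
  measure and the sum of two measures are both defined by \<open>measure_of\<close>.
\<close>

lemma nn_integral_sum_measure:
  fixes P :: "'i \<Rightarrow> 'a measure"
  assumes N: "sets N = sets S" and P: "\<And>n. sets (P n) = sets S"
    and sum: "\<And>G. G \<in> sets S \<Longrightarrow> emeasure N G = (\<integral>\<^sup>+ n. emeasure (P n) G \<partial>count_space UNIV)"
    and f: "f \<in> borel_measurable S"
  shows "(\<integral>\<^sup>+ x. f x \<partial>N) = (\<integral>\<^sup>+ n. (\<integral>\<^sup>+ x. f x \<partial>P n) \<partial>count_space UNIV)"
  using f
proof (induction rule: borel_measurable_induct)
  case (cong f g)
  have "(\<integral>\<^sup>+ x. f x \<partial>X) = (\<integral>\<^sup>+ x. g x \<partial>X)" if "sets X = sets S" for X
    using sets_eq_imp_space_eq[OF that] cong(3) by (intro nn_integral_cong) simp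
  then show ?case using cong(4) N P by simp
next
  case (set G)
  then show ?case using sum[of G] N P by simp
next
  case (mult u c)
  have scale: "(\<integral>\<^sup>+ x. c * u x \<partial>X) = c * (\<integral>\<^sup>+ x. u x \<partial>X)" if "sets X = sets S" for X
    using mult(2) measurable_cong_sets[OF that refl] by (intro nn_integral_cmult) blast
  show ?case
    unfolding scale[OF N] scale[OF P] using mult.IH by (simp add: nn_integral_cmult)
next
  case (add u v)
  have plus: "(\<integral>\<^sup>+ x. v x + u x \<partial>X) = (\<integral>\<^sup>+ x. v x \<partial>X) + (\<integral>\<^sup>+ x. u x \<partial>X)" if "sets X = sets S" for X
    using add measurable_cong_sets[OF that refl] by (intro nn_integral_add) blast+
  show ?case
    unfolding plus[OF N] plus[OF P] using add.IH by (simp add: nn_integral_add)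
next
  case (seq U)
  have U: "U i \<in> borel_measurable X" if "sets X = sets S" for i X
    using seq(1) measurable_cong_sets[OF that refl] by blast
  have inc: "incseq (\<lambda>i n. \<integral>\<^sup>+ x. U i x \<partial>P n)"
    using \<open>incseq U\<close> by (auto simp: incseq_def le_fun_def intro!: nn_integral_mono)
  have "(\<integral>\<^sup>+ x. (SUP i. U i) x \<partial>N) = (SUP i. \<integral>\<^sup>+ x. U i x \<partial>N)"
    unfolding SUP_apply by (rule nn_integral_monotone_convergence_SUP[OF \<open>incseq U\<close> U[OF N]])
  also have "\<dots> = (SUP i. \<integral>\<^sup>+ n. (\<integral>\<^sup>+ x. U i x \<partial>P n) \<partial>count_space UNIV)"
    by (simp only: seq.IH)
  also have "\<dots> = (\<integral>\<^sup>+ n. (SUP i. \<integral>\<^sup>+ x. U i x \<partial>P n) \<partial>count_space UNIV)"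
    by (rule nn_integral_monotone_convergence_SUP[OF inc, symmetric]) simp
  also have "\<dots> = (\<integral>\<^sup>+ n. (\<integral>\<^sup>+ x. (SUP i. U i) x \<partial>P n) \<partial>count_space UNIV)"
    unfolding SUP_apply
    by (simp only: nn_integral_monotone_convergence_SUP[OF \<open>incseq U\<close> U[OF P]])
  finally show ?case .
qed

text \<open>
  A homomorphism from the integers to the automorphisms of the disc. The matrices with entries \<open>A n\<close> and
  \<open>B n\<close> are normalized to be twice the identity at \<open>n = 0\<close>, whence the factor \<open>2\<close> in the composition laws;
  both families of interest satisfy them with this factor and without square roots.
\<close>

locale disc_group =
  fixes A B :: "int \<Rightarrow> complex" and \<phi> \<psi> :: "complex \<Rightarrow> complex"
  assumes norm_B_less: "\<And>n. cmod (B n) < cmod (A n)"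
    and A_0: "A 0 = 2" and B_0: "B 0 = 0"
    and A_add: "\<And>m n. 2 * A (m + n) = A m * A n + B m * cnj (B n)"
    and B_add: "\<And>m n. 2 * B (m + n) = A m * B n + B m * cnj (A n)"
    and \<phi>_eq: "\<phi> = mob (A 1) (B 1)" and \<psi>_eq: "\<psi> = mob (A (- 1)) (B (- 1))"
    and inverses: "circle_inverses \<phi> \<psi>"
begin

abbreviation flow :: "int \<Rightarrow> complex \<Rightarrow> complex" where
  "flow n \<equiv> mob (A n) (B n)"

abbreviation speed :: "int \<Rightarrow> complex \<Rightarrow> real" where
  "speed n \<equiv> jac (A n) (B n)"

abbreviation shift :: "int \<Rightarrow> complex measure \<Rightarrow> complex measure" where
  "shift n \<equiv> push (A n) (B n)"

sublocale disc_aut "A n" "B n" for n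
  by unfold_locales (rule norm_B_less)

lemma flow_add: "cmod z \<le> 1 \<Longrightarrow> flow m (flow n z) = flow (m + n) z"
  using mob_mob(1)[OF disc_aut_axioms disc_aut_axioms, of z m n] A_add[of m n] B_add[of m n]
  by (metis mob_double(1))

lemma speed_add: "cmod z \<le> 1 \<Longrightarrow> speed m (flow n z) * speed n z = speed (m + n) z"
  using mob_mob(2)[OF disc_aut_axioms disc_aut_axioms, of z m n] A_add[of m n] B_add[of m n]
  by (metis mob_double(2))

lemma flow_0 [simp]: "flow 0 z = z" and speed_0 [simp]: "speed 0 z = 1"
  by (simp_all add: A_0 B_0 mob_def jac_def)

lemma flow_cball: "cmod (flow n z) \<le> 1" if "cmod z \<le> 1"
  using that mob_sphere[of z n] mob_ball[of z n] by (cases "cmod z = 1") auto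

text \<open>
  The maps \<open>flow\<close> compose only where no denominator vanishes, so iterates agree with them
  on the closed disc but not as total functions. The derivative at a boundary point is therefore
  obtained from the chain rule along the orbit.
\<close>

lemma iterate_flow:
  assumes "cmod z \<le> 1"
  shows "(flow s ^^ k) z = flow (int k * s) z \<and>
    (\<exists>d. ((flow s ^^ k) has_field_derivative d) (at z) \<and> cmod d = speed (int k * s) z)"
proof (induction k)
  case 0
  have "((\<lambda>x. x) has_field_derivative 1) (at z)" by (rule DERIV_ident)
  then show ?case by (auto simp: id_def intro!: exI[of _ 1])
next
  case (Suc k)
  let ?w = "flow (int k * s) z"
  let ?e = "of_real ((cmod (A s))\<^sup>2 - (cmod (B s))\<^sup>2) / (cnj (B s) * ?w + cnj (A s))\<^sup>2"
  obtain d where d: "((flow s ^^ k) has_field_derivative d) (at z)" "cmod d = speed (int k * s) z"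
    using Suc by blast
  have w: "(flow s ^^ k) z = ?w" using Suc by blast
  have "((flow s \<circ> flow s ^^ k) has_field_derivative (?e * d)) (at z)"
    using d(1) has_field_derivative_mob[of ?w s] flow_cball[OF assms]
    by (intro DERIV_chain) (simp_all add: w)
  moreover have "cmod (?e * d) = speed (s + int k * s) z"
    unfolding norm_mult cmod_deriv_mob d(2) speed_add[OF assms] ..
  moreover have "(flow s ^^ Suc k) z = flow (s + int k * s) z"
    by (simp add: w flow_add[OF assms])
  moreover have "int (Suc k) * s = s + int k * s" by (simp add: algebra_simps)
  ultimately show ?case unfolding funpow.simps by metis
qed

lemma aut_iter_flow:
  assumes "cmod z \<le> 1"
  shows "aut_iter \<phi> \<psi> n z = flow n z" and "cmod (deriv (aut_iter \<phi> \<psi> n) z) = speed n z"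
proof -
  have "aut_iter \<phi> \<psi> n = (flow (if n \<ge> 0 then 1 else - 1) ^^ nat \<bar>n\<bar>)"
    by (simp add: aut_iter_def \<phi>_eq \<psi>_eq)
  moreover have "int (nat \<bar>n\<bar>) * (if n \<ge> 0 then 1 else - 1) = n" by simp
  ultimately show "aut_iter \<phi> \<psi> n z = flow n z" "cmod (deriv (aut_iter \<phi> \<psi> n) z) = speed n z"
    using iterate_flow[OF assms, where s = "if n \<ge> 0 then 1 else - 1" and k = "nat \<bar>n\<bar>"]
    by (metis DERIV_imp_deriv)+
qed

lemma nu_part_eq_shift:
  assumes M: "sets M = sets circle"
  shows "nu_part \<phi> \<psi> M n = shift n M"
proof (rule measure_eqI)
  fix G assume "G \<in> sets (nu_part \<phi> \<psi> M n)"
  then have G: "G \<in> sets circle" by simp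
  then have sub: "G \<subseteq> sphere 0 1" by (auto simp: sets_circle)
  have sp: "space M = sphere 0 1" using sets_eq_imp_space_eq[OF M] by simp
  have "emeasure (nu_part \<phi> \<psi> M n) G =
      (\<integral>\<^sup>+ \<zeta> \<in> aut_iter \<phi> \<psi> (- n) ` G. ennreal (cmod (deriv (aut_iter \<phi> \<psi> n) \<zeta>)) \<partial>M)"
    by (rule emeasure_nu_part[OF inverses M G])
  also have "\<dots> = (\<integral>\<^sup>+ \<zeta>. ennreal (speed n \<zeta>) * indicator G (flow n \<zeta>) \<partial>M)"
    unfolding aut_iter_image[OF inverses sub]
    by (intro nn_integral_cong) (auto simp: sp aut_iter_flow indicator_def)
  also have "\<dots> = emeasure (shift n M) G"
    by (rule emeasure_push[OF M G, symmetric])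
  finally show "emeasure (nu_part \<phi> \<psi> M n) G = emeasure (shift n M) G" .
qed simp

lemma shift_shift:
  assumes M: "sets M = sets circle"
  shows "shift m (shift n M) = shift (m + n) M"
proof (rule measure_eqI)
  fix G assume "G \<in> sets (shift m (shift n M))"
  then have G[measurable]: "G \<in> sets circle" by simp
  have sp: "space M = sphere 0 1" using sets_eq_imp_space_eq[OF M] by simp
  have "emeasure (shift m (shift n M)) G =
      (\<integral>\<^sup>+ \<zeta>. ennreal (speed m \<zeta>) * indicator G (flow m \<zeta>) \<partial>shift n M)"
    by (rule emeasure_push) (simp_all add: G)
  also have "\<dots> = (\<integral>\<^sup>+ \<zeta>. ennreal (speed n \<zeta>) *
      (ennreal (speed m (flow n \<zeta>)) * indicator G (flow m (flow n \<zeta>))) \<partial>M)"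
    by (rule nn_integral_push[OF M]) measurable
  also have "\<dots> = (\<integral>\<^sup>+ \<zeta>. ennreal (speed (m + n) \<zeta>) * indicator G (flow (m + n) \<zeta>) \<partial>M)"
  proof (rule nn_integral_cong)
    fix \<zeta> assume "\<zeta> \<in> space M"
    then have z: "cmod \<zeta> \<le> 1" by (simp add: sp)
    have "ennreal (speed n \<zeta>) * (ennreal (speed m (flow n \<zeta>)) * c) =
        ennreal (speed m (flow n \<zeta>) * speed n \<zeta>) * c" for c
      using jac_pos[OF z, of n] by (simp add: ennreal_mult' mult.commute mult.left_commute)
    then show "ennreal (speed n \<zeta>) * (ennreal (speed m (flow n \<zeta>)) * indicator G (flow m (flow n \<zeta>))) =
        ennreal (speed (m + n) \<zeta>) * indicator G (flow (m + n) \<zeta>)"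
      by (simp add: flow_add[OF z] speed_add[OF z])
  qed
  also have "\<dots> = emeasure (shift (m + n) M) G"
    by (rule emeasure_push[OF M G, symmetric])
  finally show "emeasure (shift m (shift n M)) G = emeasure (shift (m + n) M) G" .
qed simp

lemma shift_0:
  assumes M: "sets M = sets circle"
  shows "shift 0 M = M"
proof (rule measure_eqI)
  fix G assume "G \<in> sets (shift 0 M)"
  then show "emeasure (shift 0 M) G = emeasure M G"
    using emeasure_push[OF M, of G 0] by (simp add: M)
qed (simp add: M)

lemma shift_invariant:
  assumes M: "sets M = sets circle" and inv: "shift 1 M = M"
  shows "shift n M = M"
proof (induction n rule: int_induct[where k = 0])
  case base
  then show ?case by (rule shift_0[OF M])
next
  case (step1 n)
  then show ?case using shift_shift[OF M, of 1 n] inv by (simp add: add.commute)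
next
  case (step2 n)
  have "shift (- 1) M = shift (- 1) (shift 1 M)" by (simp only: inv)
  also have "\<dots> = M" using shift_shift[OF M, of "- 1" 1] shift_0[OF M] by simp
  finally show ?case using step2 shift_shift[OF M, of "- 1" n] by simp
qed

lemma emeasure_nu_eq:
  assumes "sets M = sets circle" "G \<in> sets circle"
  shows "emeasure (nu \<phi> \<psi> M) G = (\<integral>\<^sup>+ n. emeasure (shift n M) G \<partial>count_space UNIV)"
  using emeasure_nu[OF assms(2)] nu_part_eq_shift[OF assms(1)] by simp

lemma nn_integral_nu:
  assumes M: "sets M = sets circle" and f: "f \<in> borel_measurable circle"
  shows "(\<integral>\<^sup>+ \<zeta>. f \<zeta> \<partial>nu \<phi> \<psi> M) = (\<integral>\<^sup>+ n. (\<integral>\<^sup>+ \<zeta>. f \<zeta> \<partial>shift n M) \<partial>count_space UNIV)"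
  by (rule nn_integral_sum_measure[OF sets_nu sets_push emeasure_nu_eq[OF M] f])

text \<open>
  The automorphism moves the \<open>n\<close>-th summand to the summand of index \<open>1 + n\<close>.
\<close>

lemma shift_nu:
  assumes M: "sets M = sets circle"
  shows "shift 1 (nu \<phi> \<psi> M) = nu \<phi> \<psi> M"
proof (rule measure_eqI)
  fix G assume "G \<in> sets (shift 1 (nu \<phi> \<psi> M))"
  then have G[measurable]: "G \<in> sets circle" by simp
  have "emeasure (shift 1 (nu \<phi> \<psi> M)) G =
      (\<integral>\<^sup>+ \<zeta>. ennreal (speed 1 \<zeta>) * indicator G (flow 1 \<zeta>) \<partial>nu \<phi> \<psi> M)"
    by (rule emeasure_push) (simp_all add: G)
  also have "\<dots> = (\<integral>\<^sup>+ n. (\<integral>\<^sup>+ \<zeta>. ennreal (speed 1 \<zeta>) * indicator G (flow 1 \<zeta>) \<partial>shift n M) \<partial>count_space UNIV)"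
    by (rule nn_integral_nu[OF M]) measurable
  also have "\<dots> = (\<integral>\<^sup>+ n. emeasure (shift (1 + n) M) G \<partial>count_space UNIV)"
    by (intro nn_integral_cong) (simp add: emeasure_push[OF sets_push G, symmetric] shift_shift[OF M])
  also have "\<dots> = (\<integral>\<^sup>+ n. emeasure (shift n M) G \<partial>count_space UNIV)"
    by (rule nn_integral_bij_count_space) (auto intro!: bij_betwI[where g = "\<lambda>n. n - 1"])
  also have "\<dots> = emeasure (nu \<phi> \<psi> M) G"
    by (rule emeasure_nu_eq[OF M G, symmetric])
  finally show "emeasure (shift 1 (nu \<phi> \<psi> M)) G = emeasure (nu \<phi> \<psi> M) G" .
qed simp

text \<open>
  The total mass of the \<open>n\<close>-th summand is at most \<open>g n\<close> times the mass of \<open>M\<close>. A null set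
  that carries the sum is the union of the countably many images of one that carries \<open>M\<close>.
\<close>

lemma singular_nu:
  assumes M: "singular_measure M" "concentrated_in M J" and J: "J \<in> sets circle"
    and bound: "\<And>n \<zeta>. \<zeta> \<in> J \<Longrightarrow> speed n \<zeta> \<le> g n"
    and g: "(\<integral>\<^sup>+ n. ennreal (g n) \<partial>count_space UNIV) < \<infinity>"
  shows "singular_measure (nu \<phi> \<psi> M)"
proof -
  interpret circle_measure M by (rule singular_measure_circle) fact
  have sp: "space (nu \<phi> \<psi> M) = sphere 0 1" using sets_eq_imp_space_eq[OF sets_nu] by simp
  have inJ: "AE \<zeta> in M. \<zeta> \<in> J"
  proof (rule AE_I)
    show "{\<zeta> \<in> space M. \<not> \<zeta> \<in> J} \<subseteq> sphere 0 1 - J" by auto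
    show "emeasure M (sphere 0 1 - J) = 0" using M(2) by (simp add: concentrated_in_def)
    show "sphere 0 1 - J \<in> sets M" using J by (intro sets.Diff) simp_all
  qed
  have "emeasure (shift n M) (sphere 0 1) \<le> ennreal (g n) * emeasure M (sphere 0 1)" for n
  proof -
    have "emeasure (shift n M) (sphere 0 1) =
        (\<integral>\<^sup>+ \<zeta>. ennreal (speed n \<zeta>) * indicator (sphere 0 1) (flow n \<zeta>) \<partial>M)"
      by (rule emeasure_push) simp_all
    also have "\<dots> \<le> (\<integral>\<^sup>+ \<zeta>. ennreal (g n) \<partial>M)"
      using inJ bound by (intro nn_integral_mono_AE) (auto elim!: eventually_mono simp: indicator_def intro!: ennreal_leI)
    finally show ?thesis by simp
  qed
  then have "emeasure (nu \<phi> \<psi> M) (sphere 0 1) \<le>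
      (\<integral>\<^sup>+ n. ennreal (g n) * emeasure M (sphere 0 1) \<partial>count_space UNIV)"
    by (simp add: emeasure_nu_eq nn_integral_mono)
  also have "\<dots> = (\<integral>\<^sup>+ n. ennreal (g n) \<partial>count_space UNIV) * emeasure M (sphere 0 1)"
    by (rule nn_integral_multc) simp
  also have "\<dots> < \<infinity>" using g by (simp add: ennreal_mult_less_top emeasure_eq_measure)
  finally have fin: "finite_measure (nu \<phi> \<psi> M)"
    by (intro finite_measureI) (simp add: sp)
  obtain N where N: "N \<in> sets circle" "emeasure arc_length N = 0" "emeasure M (sphere 0 1 - N) = 0"
    using M unfolding singular_measure_def by blast
  define N' where "N' = (\<Union>n. {\<zeta> \<in> sphere 0 1. flow n \<zeta> \<in> N})"
  have null: "{\<zeta> \<in> sphere 0 1. flow n \<zeta> \<in> N} \<in> null_sets arc_length" for n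
  proof -
    have "flow n -` N \<inter> space circle \<in> sets circle"
      using N(1) by (intro measurable_sets[of _ _ circle]) auto
    also have "flow n -` N \<inter> space circle = {\<zeta> \<in> sphere 0 1. flow n \<zeta> \<in> N}" by auto
    finally show ?thesis
      using arc_length_preimage_null[OF N(1,2), of n] circle_measure.sets_M[OF circle_measure_arc_length]
      by (intro null_setsI) auto
  qed
  then have N'_null: "N' \<in> null_sets arc_length"
    unfolding N'_def by (rule null_sets_UN)
  then have N': "N' \<in> sets circle" "emeasure arc_length N' = 0"
    using circle_measure.sets_M[OF circle_measure_arc_length] by (auto simp: null_sets_def)
  have shift_null: "emeasure (shift n M) (sphere 0 1 - N') = 0" for n
  proof (rule emeasure_push_eq_0[OF sets_M N(1,3)])
    show "sphere 0 1 - N' \<in> sets circle" using N'(1) by auto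
    fix \<zeta> :: complex assume "\<zeta> \<in> sphere 0 1" "\<zeta> \<in> N"
    then have "flow (- n) (flow n \<zeta>) \<in> N" by (simp add: flow_add)
    then show "flow n \<zeta> \<notin> sphere 0 1 - N'"
      by (auto simp: N'_def)
  qed
  have "sphere 0 1 - N' \<in> sets circle" using N'(1) by (intro sets.Diff) simp_all
  then have "emeasure (nu \<phi> \<psi> M) (sphere 0 1 - N') = 0"
    using emeasure_nu_eq[OF sets_M] shift_null by simp
  then show ?thesis
    unfolding singular_measure_def using fin N' by auto
qed

text \<open>
  By invariance the \<open>n\<close>-th summand is the restriction of \<open>M\<close> to the \<open>n\<close>-th image of \<open>J\<close>, and
  these images partition the complement of \<open>E\<close>.
\<close>

lemma nu_restrict_invariant:
  assumes M: "sets M = sets circle" and inv: "shift 1 M = M"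
    and J: "J \<in> sets circle" and G: "G \<in> sets circle"
    and fund: "\<And>\<zeta>. \<zeta> \<in> sphere 0 1 \<Longrightarrow> \<zeta> \<notin> E \<Longrightarrow> \<exists>!n. flow n \<zeta> \<in> J"
    and fixed: "\<And>\<zeta> n. \<zeta> \<in> sphere 0 1 \<Longrightarrow> \<zeta> \<in> E \<Longrightarrow> flow n \<zeta> \<notin> J"
  shows "emeasure (nu \<phi> \<psi> (restrict_to M J)) G = emeasure M (G - E)"
proof -
  \<comment> \<open>the part of \<open>G\<close> in the \<open>n\<close>-th image of \<open>J\<close>\<close>
  define X where "X n = {\<zeta> \<in> G. flow (- n) \<zeta> \<in> J}" for n
  have sub: "G \<subseteq> sphere 0 1" using G by (auto simp: sets_circle)
  have X: "X n \<in> sets circle" for n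
  proof -
    have "flow (- n) -` J \<inter> space circle \<in> sets circle"
      using J by (intro measurable_sets[of _ _ circle]) auto
    then have "G \<inter> (flow (- n) -` J \<inter> space circle) \<in> sets circle"
      using G by blast
    also have "G \<inter> (flow (- n) -` J \<inter> space circle) = X n" using sub by (auto simp: X_def)
    finally show ?thesis .
  qed
  have sp: "space M = sphere 0 1" using sets_eq_imp_space_eq[OF M] by simp
  have R: "sets (restrict_to M J) = sets circle" by (simp add: restrict_to_def M)
  have "emeasure (shift n (restrict_to M J)) G = emeasure M (X n)" for n
  proof -
    have "emeasure (shift n (restrict_to M J)) G =
        (\<integral>\<^sup>+ \<zeta>. ennreal (speed n \<zeta>) * indicator G (flow n \<zeta>) \<partial>restrict_to M J)"
      by (rule emeasure_push[OF R G])
    also have "\<dots> = (\<integral>\<^sup>+ \<zeta>. indicator J \<zeta> * (ennreal (speed n \<zeta>) * indicator G (flow n \<zeta>)) \<partial>M)"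
      unfolding restrict_to_def
    proof (rule nn_integral_density)
      show "indicator J \<in> borel_measurable M" using J M by simp
      have "(\<lambda>\<zeta>. ennreal (speed n \<zeta>) * indicator G (flow n \<zeta>)) \<in> borel_measurable circle"
        using G by measurable
      then show "(\<lambda>\<zeta>. ennreal (speed n \<zeta>) * indicator G (flow n \<zeta>)) \<in> borel_measurable M"
        by (simp cong: measurable_cong_sets add: M)
    qed
    also have "\<dots> = (\<integral>\<^sup>+ \<zeta>. ennreal (speed n \<zeta>) * indicator (X n) (flow n \<zeta>) \<partial>M)"
    proof (rule nn_integral_cong)
      fix \<zeta> assume "\<zeta> \<in> space M"
      then have "flow (- n) (flow n \<zeta>) = \<zeta>" using flow_add[of \<zeta> "- n" n] by (simp add: sp)
      then show "indicator J \<zeta> * (ennreal (speed n \<zeta>) * indicator G (flow n \<zeta>)) =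
          ennreal (speed n \<zeta>) * indicator (X n) (flow n \<zeta>)"
        by (auto simp: X_def indicator_def)
    qed
    also have "\<dots> = emeasure (shift n M) (X n)"
      by (rule emeasure_push[OF M X, symmetric])
    also have "\<dots> = emeasure M (X n)" by (simp add: shift_invariant[OF M inv])
    finally show ?thesis .
  qed
  then have "emeasure (nu \<phi> \<psi> (restrict_to M J)) G = (\<integral>\<^sup>+ n. emeasure M (X n) \<partial>count_space UNIV)"
    by (simp add: emeasure_nu_eq[OF R G])
  also have "\<dots> = emeasure M (\<Union>n. X n)"
  proof (rule emeasure_UN_countable[symmetric])
    show "disjoint_family X"
      unfolding disjoint_family_on_def
    proof (intro ballI impI)
      fix m n :: int assume "m \<noteq> n"
      have False if "\<zeta> \<in> X m" "\<zeta> \<in> X n" for \<zeta>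
      proof -
        have "\<zeta> \<in> sphere 0 1" "flow (- m) \<zeta> \<in> J" "flow (- n) \<zeta> \<in> J"
          using that sub by (auto simp: X_def)
        then have "- m = - n" using fund fixed by blast
        then show False using \<open>m \<noteq> n\<close> by simp
      qed
      then show "X m \<inter> X n = {}" by blast
    qed
  qed (use X M in auto)
  also have "(\<Union>n. X n) = G - E"
  proof -
    have "\<exists>n. flow (- n) \<zeta> \<in> J" if "\<zeta> \<in> G - E" for \<zeta>
      using fund[of \<zeta>] that sub by (metis Diff_iff minus_minus subsetD)
    then show ?thesis using fixed sub by (auto simp: X_def)
  qed
  finally show ?thesis .
qed

end

section \<open>Restrictions and point masses\<close>

lemma singular_restrict_to:
  assumes M: "singular_measure M" and J: "J \<in> sets circle"
  shows "singular_measure (restrict_to M J)" "concentrated_in (restrict_to M J) J"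
proof -
  interpret circle_measure M by (rule singular_measure_circle[OF M])
  have em: "emeasure (restrict_to M J) G = emeasure M (J \<inter> G)" if "G \<in> sets circle" for G
  proof -
    have "emeasure (restrict_to M J) G = (\<integral>\<^sup>+ \<zeta>. indicator J \<zeta> * indicator G \<zeta> \<partial>M)"
      unfolding restrict_to_def using that J by (intro emeasure_density) auto
    also have "\<dots> = (\<integral>\<^sup>+ \<zeta>. indicator (J \<inter> G) \<zeta> \<partial>M)"
      by (intro nn_integral_cong) (simp add: indicator_def)
    finally show ?thesis using that J by simp
  qed
  obtain N where N: "N \<in> sets circle" "emeasure arc_length N = 0" "emeasure M (sphere 0 1 - N) = 0"
    using M unfolding singular_measure_def by blast
  have compl: "sphere 0 1 - G \<in> sets circle" if "G \<in> sets circle" for G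
    using that by (intro sets.Diff) simp_all
  have "emeasure M (J \<inter> (sphere 0 1 - N)) \<le> emeasure M (sphere 0 1 - N)"
    using compl[OF N(1)] by (intro emeasure_mono) auto
  then have "emeasure (restrict_to M J) (sphere 0 1 - N) = 0"
    using em[OF compl[OF N(1)]] N(3) by simp
  moreover have "finite_measure (restrict_to M J)"
  proof (rule finite_measureI)
    have "space (restrict_to M J) = sphere 0 1" by (simp add: restrict_to_def)
    then show "emeasure (restrict_to M J) (space (restrict_to M J)) \<noteq> \<infinity>"
      using em[of "sphere 0 1"] by (simp add: emeasure_eq_measure)
  qed
  ultimately show "singular_measure (restrict_to M J)"
    unfolding singular_measure_def using N by (auto simp: restrict_to_def)
  have "J \<inter> (sphere 0 1 - J) = {}" by blast
  then show "concentrated_in (restrict_to M J) J"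
    unfolding concentrated_in_def using em[OF compl[OF J]] by simp
qed

lemma sets_add_measure [simp]: "sets (add_measure M N) = sets M"
  by (simp add: add_measure_def)

lemma nn_integral_add_measure:
  assumes M: "sets M = sets S" and N: "sets N = sets S" and f: "f \<in> borel_measurable S"
  shows "(\<integral>\<^sup>+ x. f x \<partial>add_measure M N) = (\<integral>\<^sup>+ x. f x \<partial>M) + (\<integral>\<^sup>+ x. f x \<partial>N)"
proof -
  have bool: "(\<integral>\<^sup>+ i. h i \<partial>count_space UNIV) = h True + h False" for h :: "bool \<Rightarrow> ennreal"
    by (simp add: nn_integral_count_space_finite UNIV_bool add.commute)
  have "(\<integral>\<^sup>+ x. f x \<partial>add_measure M N) =
      (\<integral>\<^sup>+ i. (\<integral>\<^sup>+ x. f x \<partial>(if i then M else N)) \<partial>count_space UNIV)"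
  proof (rule nn_integral_sum_measure[OF _ _ _ f])
    fix G assume "G \<in> sets S"
    then show "emeasure (add_measure M N) G =
        (\<integral>\<^sup>+ i. emeasure (if i then M else N) G \<partial>count_space UNIV)"
      using emeasure_add_measure[of M N G] M N by (simp add: bool)
  qed (simp_all add: M N)
  then show ?thesis by (simp add: bool)
qed

lemma singular_inner_functionI:
  "singular_measure M \<Longrightarrow> singular_inner_function (sing_inner M)"
  unfolding singular_inner_function_def by blast

lemma singular_add_delta1:
  assumes M: "singular_measure M"
  shows "singular_measure (add_measure M (scale_measure (ennreal a) delta1))"
proof -
  interpret circle_measure M by (rule singular_measure_circle[OF M])
  let ?D = "scale_measure (ennreal a) delta1"
  have em: "emeasure (add_measure M ?D) G = emeasure M G + ennreal a * indicator G 1"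
    if "G \<in> sets circle" for G
    using that emeasure_add_measure[of M ?D G] by simp
  obtain N where N: "N \<in> sets circle" "emeasure arc_length N = 0" "emeasure M (sphere 0 1 - N) = 0"
    using M unfolding singular_measure_def by blast
  have one: "{1} \<in> sets circle" by (auto simp: sets_circle)
  have ins: "insert 1 N \<in> sets circle" using sets.Un[OF one N(1)] by simp
  have L: "sets arc_length = sets circle" by (rule circle_measure.sets_M[OF circle_measure_arc_length])
  have "{1} \<union> N \<in> null_sets arc_length"
    using N one arc_length_one by (intro null_sets.Un) (auto simp: null_sets_def L)
  then have null: "emeasure arc_length (insert 1 N) = 0" by (simp add: null_sets_def)
  have "emeasure M (sphere 0 1 - insert 1 N) \<le> emeasure M (sphere 0 1 - N)"
    using N(1) by (intro emeasure_mono sets.Diff) auto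
  then have "emeasure (add_measure M ?D) (sphere 0 1 - insert 1 N) = 0"
    using em[of "sphere 0 1 - insert 1 N"] ins N(3) by (simp add: sets.Diff)
  moreover have "finite_measure (add_measure M ?D)"
  proof (rule finite_measureI)
    have "space (add_measure M ?D) = sphere 0 1"
      using sets_eq_imp_space_eq[OF sets_add_measure, of M ?D] by simp
    then show "emeasure (add_measure M ?D) (space (add_measure M ?D)) \<noteq> \<infinity>"
      using em[of "sphere 0 1"] by (simp add: emeasure_eq_measure)
  qed
  ultimately show ?thesis
    unfolding singular_measure_def using ins null by auto
qed

context disc_group
begin

lemma flow_eq_fixed_iff:
  assumes "cmod p \<le> 1" "flow 1 p = p" "cmod z \<le> 1"
  shows "flow 1 z = p \<longleftrightarrow> z = p"
  using assms flow_add[of p "- 1" 1] flow_add[of z "- 1" 1] by auto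

text \<open>
  Invariance at a fixed point \<open>p\<close> says that the mass of \<open>p\<close> equals \<open>speed 1 p\<close> times itself.
\<close>

lemma fixed_point_null:
  assumes M: "circle_measure M" and inv: "shift 1 M = M"
    and p: "p \<in> sphere 0 1" "flow 1 p = p" "speed 1 p \<noteq> 1"
  shows "emeasure M {p} = 0"
proof -
  interpret circle_measure M by fact
  have P: "{p} \<in> sets circle" using p(1) by (auto simp: sets_circle)
  have "emeasure M {p} = emeasure (shift 1 M) {p}" by (simp only: inv)
  also have "\<dots> = (\<integral>\<^sup>+ \<zeta>. ennreal (speed 1 \<zeta>) * indicator {p} (flow 1 \<zeta>) \<partial>M)"
    by (rule emeasure_push[OF sets_M P])
  also have "\<dots> = (\<integral>\<^sup>+ \<zeta>. ennreal (speed 1 p) * indicator {p} \<zeta> \<partial>M)"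
    using p(1) by (intro nn_integral_cong) (auto simp: indicator_def flow_eq_fixed_iff[OF _ p(2)] p(2))
  also have "\<dots> = ennreal (speed 1 p) * emeasure M {p}"
    using P by (simp add: nn_integral_cmult)
  also have "\<dots> = ennreal (speed 1 p * measure M {p})"
    using jac_pos[of p 1] p(1) by (simp add: emeasure_eq_measure ennreal_mult)
  finally have "measure M {p} = speed 1 p * measure M {p}"
    using jac_pos[of p 1] p(1) by (simp add: emeasure_eq_measure)
  then show ?thesis using p(3) by (simp add: emeasure_eq_measure)
qed

text \<open>
  At a fixed point where the derivative has modulus \<open>1\<close>, a point mass is invariant by itself.
\<close>

lemma shift_add_delta1:
  assumes M: "sets M = sets circle" "shift 1 M = M" and one: "flow 1 1 = 1" "speed 1 1 = 1"
  shows "shift 1 (add_measure M (scale_measure c delta1)) = add_measure M (scale_measure c delta1)"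
proof (rule measure_eqI)
  let ?D = "scale_measure c delta1"
  have D: "sets ?D = sets circle" by simp
  fix G assume "G \<in> sets (shift 1 (add_measure M ?D))"
  then have G[measurable]: "G \<in> sets circle" by simp
  let ?f = "\<lambda>\<zeta>. ennreal (speed 1 \<zeta>) * indicator G (flow 1 \<zeta>)"
  have f: "?f \<in> borel_measurable circle" by measurable
  have "emeasure (shift 1 (add_measure M ?D)) G = (\<integral>\<^sup>+ \<zeta>. ?f \<zeta> \<partial>add_measure M ?D)"
    by (rule emeasure_push) (simp_all add: M(1) G)
  also have "\<dots> = (\<integral>\<^sup>+ \<zeta>. ?f \<zeta> \<partial>M) + (\<integral>\<^sup>+ \<zeta>. ?f \<zeta> \<partial>?D)"
    by (rule nn_integral_add_measure[OF M(1) D f])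
  also have "(\<integral>\<^sup>+ \<zeta>. ?f \<zeta> \<partial>M) = emeasure M G"
    using emeasure_push[OF M(1) G, of 1] by (simp add: M(2))
  also have "(\<integral>\<^sup>+ \<zeta>. ?f \<zeta> \<partial>?D) = c * (\<integral>\<^sup>+ \<zeta>. ?f \<zeta> \<partial>delta1)"
    using f by (intro nn_integral_scale_measure) simp
  also have "(\<integral>\<^sup>+ \<zeta>. ?f \<zeta> \<partial>delta1) = ?f 1"
    using f by (intro nn_integral_return) simp_all
  also have "emeasure M G + c * ?f 1 = emeasure (add_measure M ?D) G"
    using emeasure_add_measure[of M ?D G] by (simp add: M(1) G one)
  finally show "emeasure (shift 1 (add_measure M ?D)) G = emeasure (add_measure M ?D) G" .
qed (simp add: M(1))

end

section \<open>Fundamental domains\<close>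

text \<open>
  In both cases of interest \<open>E\<close> is the set of fixed points on the circle, and \<open>g\<close> is a summable bound for the derivatives
  on \<open>J\<close> that makes the generated measure finite.
\<close>

locale fundamental_domain = disc_group +
  fixes J E :: "complex set" and g :: "int \<Rightarrow> real"
  assumes J: "J \<in> sets circle"
    and fund: "\<And>\<zeta>. \<zeta> \<in> sphere 0 1 \<Longrightarrow> \<zeta> \<notin> E \<Longrightarrow> \<exists>!n. flow n \<zeta> \<in> J"
    and fixed: "\<And>\<zeta> n. \<zeta> \<in> sphere 0 1 \<Longrightarrow> \<zeta> \<in> E \<Longrightarrow> flow n \<zeta> \<notin> J"
    and speed_le: "\<And>n \<zeta>. \<zeta> \<in> J \<Longrightarrow> speed n \<zeta> \<le> g n"
    and g_finite: "(\<integral>\<^sup>+ n. ennreal (g n) \<partial>count_space UNIV) < \<infinity>"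
begin

theorem generated_measure_eigen:
  assumes M: "singular_measure M" "concentrated_in M J"
  shows "singular_measure (nu \<phi> \<psi> M)" and "shift 1 (nu \<phi> \<psi> M) = nu \<phi> \<psi> M"
    and "\<exists>\<gamma>. cmod \<gamma> = 1 \<and>
      (\<forall>z\<in>ball 0 1. sing_inner (nu \<phi> \<psi> M) (\<phi> z) = \<gamma> * sing_inner (nu \<phi> \<psi> M) z)"
proof -
  show s: "singular_measure (nu \<phi> \<psi> M)"
    by (rule singular_nu[OF M J speed_le g_finite])
  show i: "shift 1 (nu \<phi> \<psi> M) = nu \<phi> \<psi> M"
    by (rule shift_nu) (rule circle_measure.sets_M[OF singular_measure_circle[OF M(1)]])
  show "\<exists>\<gamma>. cmod \<gamma> = 1 \<and>
      (\<forall>z\<in>ball 0 1. sing_inner (nu \<phi> \<psi> M) (\<phi> z) = \<gamma> * sing_inner (nu \<phi> \<psi> M) z)"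
    unfolding \<phi>_eq by (rule invariant_imp_eigen[OF singular_measure_circle[OF s] i, unfolded \<phi>_eq])
qed

theorem eigen_measure_generated:
  assumes M: "singular_measure M" and eig: "comp_eigenvector \<phi> (sing_inner M)"
  shows "shift 1 M = M"
    and "G \<in> sets circle \<Longrightarrow> emeasure (nu \<phi> \<psi> (restrict_to M J)) G = emeasure M (G - E)"
proof -
  show inv: "shift 1 M = M"
    using eig unfolding \<phi>_eq by (rule eigen_imp_invariant[OF M])
  show "emeasure (nu \<phi> \<psi> (restrict_to M J)) G = emeasure M (G - E)" if "G \<in> sets circle"
    by (rule nu_restrict_invariant[OF _ inv J that fund fixed])
      (rule circle_measure.sets_M[OF singular_measure_circle[OF M]])
qed

end

section \<open>The two normalized automorphisms\<close>

lemma nn_integral_int_finite: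
  fixes h :: "nat \<Rightarrow> real"
  assumes h: "summable h" "\<And>k. 0 \<le> h k"
  shows "(\<integral>\<^sup>+ n. ennreal (h (nat \<bar>n\<bar>)) \<partial>count_space (UNIV :: int set)) < \<infinity>"
proof -
  let ?f = "\<lambda>n :: int. ennreal (h (nat \<bar>n\<bar>))"
  have fin: "(\<integral>\<^sup>+ k. ennreal (h k) \<partial>count_space UNIV) < \<infinity>"
    using ennreal_suminf_neq_top[OF h] by (simp add: nn_integral_count_space_nat less_top)
  have half: "(\<integral>\<^sup>+ n. ?f n * indicator S n \<partial>count_space UNIV) < \<infinity>"
    if b: "bij_betw f UNIV S" "\<And>k. nat \<bar>f k\<bar> = k" for f S
  proof -
    have "(\<integral>\<^sup>+ n. ?f n * indicator S n \<partial>count_space UNIV) = (\<integral>\<^sup>+ n. ?f n \<partial>count_space S)"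
      by (subst nn_integral_count_space_indicator) auto
    also have "\<dots> = (\<integral>\<^sup>+ k. ?f (f k) \<partial>count_space UNIV)"
      by (rule nn_integral_bij_count_space[OF b(1), symmetric])
    finally show ?thesis using fin by (simp add: b(2))
  qed
  have "(\<integral>\<^sup>+ n. ?f n \<partial>count_space UNIV) \<le>
      (\<integral>\<^sup>+ n. ?f n * indicator {0..} n + ?f n * indicator {..0} n \<partial>count_space UNIV)"
    by (intro nn_integral_mono) (auto simp: indicator_def)
  also have "\<dots> = (\<integral>\<^sup>+ n. ?f n * indicator {0..} n \<partial>count_space UNIV) +
      (\<integral>\<^sup>+ n. ?f n * indicator {..0} n \<partial>count_space UNIV)"
    by (rule nn_integral_add) auto
  also have "\<dots> < \<infinity>"
  proof -
    have "bij_betw int UNIV {0..}" by (rule bij_betwI[where g = nat]) auto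
    then have "(\<integral>\<^sup>+ n. ?f n * indicator {0..} n \<partial>count_space UNIV) < \<infinity>"
      by (rule half) simp
    moreover have "bij_betw (\<lambda>k. - int k) UNIV {..0}"
      by (rule bij_betwI[where g = "\<lambda>n. nat (- n)"]) auto
    then have "(\<integral>\<^sup>+ n. ?f n * indicator {..0} n \<partial>count_space UNIV) < \<infinity>"
      by (rule half) simp
    ultimately show ?thesis by simp
  qed
  finally show ?thesis .
qed

text \<open>
  The common reason why the arcs are fundamental domains: in the hyperbolic case it is applied to the
  logarithm of the coordinate \<open>cay\<close>, in the parabolic case to the coordinate itself.
\<close>

lemma unique_translate:
  fixes x c :: real
  assumes "c > 0"
  shows "\<exists>!n :: int. 0 \<le> x + real_of_int n * c \<and> x + real_of_int n * c < c"
proof -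
  have "0 \<le> x + real_of_int n * c \<and> x + real_of_int n * c < c \<longleftrightarrow> n = - \<lfloor>x / c\<rfloor>" for n
  proof -
    have "0 \<le> x + real_of_int n * c \<and> x + real_of_int n * c < c \<longleftrightarrow>
        real_of_int (- n) \<le> x / c \<and> x / c < real_of_int (- n) + 1"
      using assms by (auto simp: field_simps)
    also have "\<dots> \<longleftrightarrow> \<lfloor>x / c\<rfloor> = - n" by (simp add: floor_eq_iff)
    finally show ?thesis by auto
  qed
  then show ?thesis by simp
qed

lemma cay_circle_real:
  assumes "\<zeta> \<in> sphere 0 1" "\<zeta> \<noteq> 1"
  obtains x :: real where "cay \<zeta> = of_real x" "\<zeta> = cay_inv (of_real x)"
proof -
  have "Im (cay \<zeta>) = 0" using Im_cay(2)[OF assms(2)] assms(1) by simp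
  then have "cay \<zeta> = of_real (Re (cay \<zeta>))" by (simp add: complex_eq_iff)
  then show ?thesis using that[of "Re (cay \<zeta>)"] cay_inv_cay[OF assms(2)] by simp
qed

lemma cmod_real_add_i: "cmod (of_real x + \<i>) ^ 2 = 1 + x\<^sup>2"
  by (simp add: cmod_power2)

lemma real_add_i_nonzero: "complex_of_real x + \<i> \<noteq> 0"
  by (simp add: complex_eq_iff)

lemma cay_disc_conj_real:
  assumes "\<zeta> \<noteq> 1" "g (cay \<zeta>) = of_real y"
  shows "disc_conj g \<zeta> \<noteq> 1" "cay (disc_conj g \<zeta>) = of_real y"
proof -
  have "complex_of_real y \<noteq> - \<i>" by (simp add: complex_eq_iff)
  then show "disc_conj g \<zeta> \<noteq> 1" "cay (disc_conj g \<zeta>) = of_real y"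
    using assms by (simp_all add: disc_conj_def cay_inv_neq_1 cay_cay_inv)
qed

text \<open>
  An equality of total functions: at \<open>1\<close> the extra clause of \<open>disc_conj\<close> supplies the right value, and at
  the pole both sides are \<open>0\<close> by the convention for division.
\<close>

lemma hyp_aut_eq_mob:
  assumes "\<beta> \<noteq> 0"
  shows "hyp_aut \<beta> = mob (of_real (\<beta> + 1)) (of_real (\<beta> - 1))"
proof
  fix z
  show "hyp_aut \<beta> z = mob (of_real (\<beta> + 1)) (of_real (\<beta> - 1)) z"
  proof (cases "z = 1")
    case True
    then show ?thesis using assms by (simp add: hyp_aut_def disc_conj_def mob_def)
  next
    case False
    then have nz: "1 - z \<noteq> 0" by simp
    have "of_real \<beta> * cay z - \<i> = (\<i> / (1 - z)) * (of_real (\<beta> + 1) * z + of_real (\<beta> - 1))"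
      "of_real \<beta> * cay z + \<i> = (\<i> / (1 - z)) * (of_real (\<beta> - 1) * z + of_real (\<beta> + 1))"
      using nz by (simp_all add: cay_def divide_simps) (simp_all add: algebra_simps)
    moreover have "\<i> / (1 - z) \<noteq> 0" using nz by simp
    ultimately show ?thesis
      using False unfolding hyp_aut_def disc_conj_def cay_inv_def mob_def complex_cnj_complex_of_real
      by (simp only: if_False mult_divide_mult_cancel_left not_False_eq_True)
  qed
qed

lemma par_aut_eq_mob: "par_aut s = mob (2 + \<i> * of_real s) (- \<i> * of_real s)"
proof
  fix z
  show "par_aut s z = mob (2 + \<i> * of_real s) (- \<i> * of_real s) z"
  proof (cases "z = 1")
    case True
    then show ?thesis by (simp add: par_aut_def disc_conj_def mob_def)
  next
    case False
    then have nz: "1 - z \<noteq> 0" by simp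
    have "cay z + of_real s - \<i> =
        (\<i> / (1 - z)) * ((2 + \<i> * of_real s) * z + (- \<i> * of_real s))"
      "cay z + of_real s + \<i> =
        (\<i> / (1 - z)) * (cnj (- \<i> * of_real s) * z + cnj (2 + \<i> * of_real s))"
      using nz by (simp_all add: cay_def divide_simps) (simp_all add: algebra_simps)
    moreover have "\<i> / (1 - z) \<noteq> 0" using nz by simp
    ultimately show ?thesis
      using False unfolding par_aut_def disc_conj_def cay_inv_def mob_def
      by (simp only: if_False mult_divide_mult_cancel_left not_False_eq_True)
  qed
qed

lemma hyp_aut_sphere: "\<zeta> \<in> sphere 0 1 \<Longrightarrow> hyp_aut \<beta> \<zeta> \<in> sphere 0 1"
  unfolding hyp_aut_def by (rule disc_conj_sphere) simp_all

lemma par_aut_sphere: "\<zeta> \<in> sphere 0 1 \<Longrightarrow> par_aut s \<zeta> \<in> sphere 0 1"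
  unfolding par_aut_def by (rule disc_conj_sphere) simp_all

text \<open>
  In the coordinate \<open>x\<close> the circle carries the length element \<open>2 dx / (1 + x\<^sup>2)\<close>, which explains the
  following two formulas for \<open>x \<mapsto> \<beta> x\<close> and \<open>x \<mapsto> x + s\<close>.
\<close>

lemma jac_hyp:
  "jac (of_real (\<beta> + 1)) (of_real (\<beta> - 1)) (cay_inv (of_real x)) =
    \<beta> * (1 + x\<^sup>2) / (1 + (\<beta> * x)\<^sup>2)"
proof -
  have "cnj (of_real (\<beta> - 1)) * cay_inv (of_real x) + cnj (of_real (\<beta> + 1)) =
      2 * (of_real (\<beta> * x) + \<i>) / (of_real x + \<i>)"
    using real_add_i_nonzero[of x] unfolding cay_inv_def complex_cnj_complex_of_real
    by (simp add: divide_simps) (simp add: algebra_simps)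
  then have "(cmod (cnj (of_real (\<beta> - 1)) * cay_inv (of_real x) + cnj (of_real (\<beta> + 1))))\<^sup>2 =
      4 * (1 + (\<beta> * x)\<^sup>2) / (1 + x\<^sup>2)"
    by (simp only: norm_divide norm_mult power_divide power_mult_distrib cmod_real_add_i) simp
  moreover have "(cmod (of_real (\<beta> + 1)))\<^sup>2 - (cmod (of_real (\<beta> - 1)))\<^sup>2 = 4 * \<beta>"
    unfolding norm_of_real power2_abs by (simp add: power2_eq_square algebra_simps)
  moreover have "4 * p / (4 * q / r) = p * r / q" for p q r :: real by simp
  ultimately show ?thesis unfolding jac_def by (simp only:)
qed

lemma jac_par:
  "jac (2 + \<i> * of_real s) (- \<i> * of_real s) (cay_inv (of_real x)) =
    (1 + x\<^sup>2) / (1 + (x + s)\<^sup>2)"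
proof -
  have "cnj (- \<i> * of_real s) * cay_inv (of_real x) + cnj (2 + \<i> * of_real s) =
      2 * (of_real (x + s) + \<i>) / (of_real x + \<i>)"
    using real_add_i_nonzero[of x] unfolding cay_inv_def
    by (simp add: divide_simps) (simp add: algebra_simps)
  then have "(cmod (cnj (- \<i> * of_real s) * cay_inv (of_real x) + cnj (2 + \<i> * of_real s)))\<^sup>2 =
      4 * (1 + (x + s)\<^sup>2) / (1 + x\<^sup>2)"
    by (simp only: norm_divide norm_mult power_divide power_mult_distrib cmod_real_add_i) simp
  moreover have "(cmod (2 + \<i> * of_real s))\<^sup>2 - (cmod (- \<i> * of_real s))\<^sup>2 = 4"
    by (simp add: cmod_power2)
  moreover have "4 / (4 * q / r) = r / q" for q r :: real by simp
  ultimately show ?thesis unfolding jac_def by (simp only:)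
qed

text \<open>
  On the arc \<open>1 \<le> \<bar>x\<bar> < \<alpha>\<close>, so with \<open>\<beta> = \<alpha> powi n\<close> the derivative is at most
  \<open>(1 + \<alpha>\<^sup>2) * \<beta> / (1 + \<beta>\<^sup>2)\<close>, and \<open>\<beta> / (1 + \<beta>\<^sup>2)\<close> lies below both \<open>\<beta>\<close> and \<open>1 / \<beta>\<close>.
\<close>

lemma fundamental_domain_hyp:
  assumes \<alpha>: "\<alpha> > 1"
  shows "fundamental_domain (\<lambda>n. of_real (\<alpha> powi n + 1)) (\<lambda>n. of_real (\<alpha> powi n - 1))
    (hyp_aut \<alpha>) (hyp_aut (1 / \<alpha>)) (hyp_arc \<alpha>) {1, - 1}
    (\<lambda>n. (1 + \<alpha>\<^sup>2) * (1 / \<alpha>) ^ nat \<bar>n\<bar>)"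
proof
  have pos: "\<alpha> powi n > 0" for n using \<alpha> by simp
  show "cmod (of_real (\<alpha> powi n - 1)) < cmod (of_real (\<alpha> powi n + 1))" for n
    using pos[of n] unfolding norm_of_real by simp
  have add: "\<alpha> powi (m + n) = \<alpha> powi m * \<alpha> powi n" for m n
    using \<alpha> by (simp add: power_int_add)
  show "2 * complex_of_real (\<alpha> powi (m + n) + 1) = of_real (\<alpha> powi m + 1) * of_real (\<alpha> powi n + 1) +
      of_real (\<alpha> powi m - 1) * cnj (of_real (\<alpha> powi n - 1))" for m n
    unfolding add by (simp add: algebra_simps)
  show "2 * complex_of_real (\<alpha> powi (m + n) - 1) = of_real (\<alpha> powi m + 1) * of_real (\<alpha> powi n - 1) +
      of_real (\<alpha> powi m - 1) * cnj (of_real (\<alpha> powi n + 1))" for m n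
    unfolding add by (simp add: algebra_simps)
  show "hyp_aut \<alpha> = mob (of_real (\<alpha> powi 1 + 1)) (of_real (\<alpha> powi 1 - 1))"
    using \<alpha> by (simp add: hyp_aut_eq_mob)
  show "hyp_aut (1 / \<alpha>) = mob (of_real (\<alpha> powi - 1 + 1)) (of_real (\<alpha> powi - 1 - 1))"
    using \<alpha> by (simp add: hyp_aut_eq_mob power_int_minus inverse_eq_divide)
  show "circle_inverses (hyp_aut \<alpha>) (hyp_aut (1 / \<alpha>))"
    using \<alpha> by (simp add: circle_inverses_hyp)
  show "hyp_arc \<alpha> \<in> sets circle" by (rule hyp_arc_measurable)
  have flow: "mob (of_real (\<alpha> powi n + 1)) (of_real (\<alpha> powi n - 1)) = hyp_aut (\<alpha> powi n)" for n
    using pos[of n] by (intro hyp_aut_eq_mob[symmetric]) linarith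
  show "\<exists>!n. mob (of_real (\<alpha> powi n + 1)) (of_real (\<alpha> powi n - 1)) \<zeta> \<in> hyp_arc \<alpha>"
    if \<zeta>: "\<zeta> \<in> sphere 0 1" "\<zeta> \<notin> {1, - 1}" for \<zeta>
  proof -
    obtain x where x: "cay \<zeta> = of_real x" "\<zeta> = cay_inv (of_real x)"
      using cay_circle_real[OF \<zeta>(1)] \<zeta>(2) by blast
    have "x \<noteq> 0" using x(2) \<zeta>(2) by (auto simp: cay_inv_def)
    have "hyp_aut (\<alpha> powi n) \<zeta> \<in> hyp_arc \<alpha> \<longleftrightarrow>
        0 \<le> ln \<bar>x\<bar> + real_of_int n * ln \<alpha> \<and> ln \<bar>x\<bar> + real_of_int n * ln \<alpha> < ln \<alpha>" for n
    proof -
      have cay: "hyp_aut (\<alpha> powi n) \<zeta> \<noteq> 1" "cay (hyp_aut (\<alpha> powi n) \<zeta>) = of_real (\<alpha> powi n * x)"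
        unfolding hyp_aut_def using \<zeta>(2) x(1)
        by (intro cay_disc_conj_real[where y = "\<alpha> powi n * x"]; simp)+
      moreover have "hyp_aut (\<alpha> powi n) \<zeta> \<in> sphere 0 1"
        using \<zeta>(1) by (rule hyp_aut_sphere)
      ultimately have "hyp_aut (\<alpha> powi n) \<zeta> \<in> hyp_arc \<alpha> \<longleftrightarrow>
          \<alpha> powi n * x \<in> {-\<alpha><..-1} \<union> {1..<\<alpha>}"
        unfolding hyp_arc_def by (simp only: mem_Collect_eq image_iff of_real_eq_iff) blast
      also have "\<dots> \<longleftrightarrow> 1 \<le> \<bar>\<alpha> powi n * x\<bar> \<and> \<bar>\<alpha> powi n * x\<bar> < \<alpha>"
        using \<alpha> by auto
      also have "\<dots> \<longleftrightarrow> 1 \<le> \<alpha> powi n * \<bar>x\<bar> \<and> \<alpha> powi n * \<bar>x\<bar> < \<alpha>"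
        using pos[of n] by (simp only: abs_mult abs_of_pos)
      also have "\<dots> \<longleftrightarrow> 0 \<le> ln (\<alpha> powi n * \<bar>x\<bar>) \<and> ln (\<alpha> powi n * \<bar>x\<bar>) < ln \<alpha>"
        using pos[of n] \<open>x \<noteq> 0\<close> \<alpha> by simp
      also have "ln (\<alpha> powi n * \<bar>x\<bar>) = ln \<bar>x\<bar> + real_of_int n * ln \<alpha>"
      proof -
        have "\<alpha> powi n = \<alpha> powr real_of_int n" using \<alpha> by (simp add: powr_real_of_int')
        then have "ln (\<alpha> powi n) = real_of_int n * ln \<alpha>" using \<alpha> by (simp add: ln_powr)
        then show ?thesis using \<alpha> pos[of n] \<open>x \<noteq> 0\<close> by (simp add: ln_mult)
      qed
      finally show ?thesis .
    qed
    then show ?thesis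
      unfolding flow using unique_translate[of "ln \<alpha>" "ln \<bar>x\<bar>"] \<alpha> by simp
  qed
  show "mob (of_real (\<alpha> powi n + 1)) (of_real (\<alpha> powi n - 1)) \<zeta> \<notin> hyp_arc \<alpha>"
    if "\<zeta> \<in> {1, - 1}" for \<zeta> n
  proof -
    have "hyp_aut (\<alpha> powi n) \<zeta> = \<zeta>"
      using that by (auto simp: hyp_aut_def disc_conj_def cay_def cay_inv_def)
    moreover have "\<zeta> \<notin> hyp_arc \<alpha>"
      using that by (auto simp: hyp_arc_def cay_def)
    ultimately show ?thesis unfolding flow by simp
  qed
  show "jac (of_real (\<alpha> powi n + 1)) (of_real (\<alpha> powi n - 1)) \<zeta> \<le> (1 + \<alpha>\<^sup>2) * (1 / \<alpha>) ^ nat \<bar>n\<bar>"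
    if \<zeta>: "\<zeta> \<in> hyp_arc \<alpha>" for n \<zeta>
  proof -
    obtain x where "x \<in> {-\<alpha><..-1} \<union> {1..<\<alpha>}" "cay \<zeta> = of_real x" "\<zeta> \<noteq> 1"
      using \<zeta> unfolding hyp_arc_def by blast
    then have "1 \<le> \<bar>x\<bar>" "\<bar>x\<bar> \<le> \<bar>\<alpha>\<bar>" and \<zeta>_eq: "\<zeta> = cay_inv (of_real x)"
      using \<alpha> cay_inv_cay[of \<zeta>] by auto
    then have x: "1 \<le> x\<^sup>2" "x\<^sup>2 \<le> \<alpha>\<^sup>2"
      using abs_le_square_iff[of 1 x] abs_le_square_iff[of x \<alpha>] by simp_all
    define \<beta> where "\<beta> = \<alpha> powi n"
    have \<beta>: "\<beta> > 0" using pos by (simp add: \<beta>_def)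
    have "jac (of_real (\<alpha> powi n + 1)) (of_real (\<alpha> powi n - 1)) \<zeta> = \<beta> * (1 + x\<^sup>2) / (1 + \<beta>\<^sup>2 * x\<^sup>2)"
      unfolding \<zeta>_eq jac_hyp \<beta>_def power_mult_distrib ..
    also have "\<dots> \<le> \<beta> * (1 + \<alpha>\<^sup>2) / (1 + \<beta>\<^sup>2)"
    proof (rule frac_le)
      show "1 + \<beta>\<^sup>2 \<le> 1 + \<beta>\<^sup>2 * x\<^sup>2" using x(1) \<beta> by simp
    qed (use \<beta> x in \<open>auto intro: add_pos_nonneg\<close>)
    also have "\<dots> \<le> (1 + \<alpha>\<^sup>2) * (1 / \<alpha>) ^ nat \<bar>n\<bar>"
    proof -
      have "\<beta> / (1 + \<beta>\<^sup>2) \<le> (1 / \<alpha>) ^ nat \<bar>n\<bar>"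
      proof (cases "n \<ge> 0")
        case True
        then have "(1 / \<alpha>) ^ nat \<bar>n\<bar> = 1 / \<beta>" by (simp add: \<beta>_def power_int_def power_one_over)
        moreover have "\<beta> / (1 + \<beta>\<^sup>2) \<le> \<beta> / \<beta>\<^sup>2" using \<beta> by (intro frac_le) auto
        moreover have "\<beta> / \<beta>\<^sup>2 = 1 / \<beta>" using \<beta> by (simp add: power2_eq_square)
        ultimately show ?thesis by (simp only:)
      next
        case False
        then have "(1 / \<alpha>) ^ nat \<bar>n\<bar> = \<beta>" by (simp add: \<beta>_def power_int_def inverse_eq_divide)
        moreover have "\<beta> / (1 + \<beta>\<^sup>2) \<le> \<beta> / 1" using \<beta> by (intro frac_le) auto
        ultimately show ?thesis by simp
      qed
      then have "(1 + \<alpha>\<^sup>2) * (\<beta> / (1 + \<beta>\<^sup>2)) \<le> (1 + \<alpha>\<^sup>2) * (1 / \<alpha>) ^ nat \<bar>n\<bar>"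
        by (intro mult_left_mono) auto
      then show ?thesis by (simp add: mult.commute)
    qed
    finally show ?thesis .
  qed
  show "(\<integral>\<^sup>+ n. ennreal ((1 + \<alpha>\<^sup>2) * (1 / \<alpha>) ^ nat \<bar>n\<bar>) \<partial>count_space (UNIV :: int set)) < \<infinity>"
    using \<alpha> by (intro nn_integral_int_finite summable_mult summable_geometric) auto
qed simp_all

text \<open>
  On the arc \<open>0 \<le> x < t\<close>, so the translate \<open>x + n t\<close> has modulus at least \<open>(\<bar>n\<bar> - 1) t\<close>; the loss of
  one period occurs for negative \<open>n\<close>. For \<open>n = 0\<close> that estimate is void because its right-hand side is
  negative, but then the derivative is \<open>1\<close>, and so is the bound, since \<open>(0 - 1)\<^sup>2 = 1\<close>.
\<close>

lemma fundamental_domain_par: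
  assumes t: "t > 0"
  shows "fundamental_domain (\<lambda>n. 2 + \<i> * of_real (real_of_int n * t)) (\<lambda>n. - \<i> * of_real (real_of_int n * t))
    (par_aut t) (par_aut (- t)) (par_arc t) {1}
    (\<lambda>n. (1 + t\<^sup>2) / (1 + ((real (nat \<bar>n\<bar>) - 1) * t)\<^sup>2))"
proof
  show "cmod (- \<i> * of_real (real_of_int n * t)) < cmod (2 + \<i> * of_real (real_of_int n * t))" for n
    by (rule power2_less_imp_less) (simp_all add: cmod_power2)
  show "2 * (2 + \<i> * of_real (real_of_int (m + n) * t)) =
      (2 + \<i> * of_real (real_of_int m * t)) * (2 + \<i> * of_real (real_of_int n * t)) +
      (- \<i> * of_real (real_of_int m * t)) * cnj (- \<i> * of_real (real_of_int n * t))" for m n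
    by (simp add: algebra_simps)
  show "2 * (- \<i> * of_real (real_of_int (m + n) * t)) =
      (2 + \<i> * of_real (real_of_int m * t)) * (- \<i> * of_real (real_of_int n * t)) +
      (- \<i> * of_real (real_of_int m * t)) * cnj (2 + \<i> * of_real (real_of_int n * t))" for m n
    by (simp add: algebra_simps)
  show "par_aut t = mob (2 + \<i> * of_real (real_of_int 1 * t)) (- \<i> * of_real (real_of_int 1 * t))"
    by (simp add: par_aut_eq_mob)
  show "par_aut (- t) = mob (2 + \<i> * of_real (real_of_int (- 1) * t)) (- \<i> * of_real (real_of_int (- 1) * t))"
    by (simp add: par_aut_eq_mob)
  show "circle_inverses (par_aut t) (par_aut (- t))" by (rule circle_inverses_par)
  show "par_arc t \<in> sets circle" by (rule par_arc_measurable)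
  have flow: "mob (2 + \<i> * of_real (real_of_int n * t)) (- \<i> * of_real (real_of_int n * t)) =
      par_aut (real_of_int n * t)" for n
    by (rule par_aut_eq_mob[symmetric])
  show "\<exists>!n. mob (2 + \<i> * of_real (real_of_int n * t)) (- \<i> * of_real (real_of_int n * t)) \<zeta> \<in> par_arc t"
    if \<zeta>: "\<zeta> \<in> sphere 0 1" "\<zeta> \<notin> {1}" for \<zeta>
  proof -
    obtain x where x: "cay \<zeta> = of_real x"
      using cay_circle_real[OF \<zeta>(1)] \<zeta>(2) by blast
    have "par_aut (real_of_int n * t) \<zeta> \<in> par_arc t \<longleftrightarrow>
        0 \<le> x + real_of_int n * t \<and> x + real_of_int n * t < t" for n
    proof -
      have "par_aut (real_of_int n * t) \<zeta> \<noteq> 1"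
        "cay (par_aut (real_of_int n * t) \<zeta>) = of_real (x + real_of_int n * t)"
        unfolding par_aut_def using \<zeta>(2) x
        by (intro cay_disc_conj_real[where y = "x + real_of_int n * t"]; simp)+
      moreover have "par_aut (real_of_int n * t) \<zeta> \<in> sphere 0 1"
        using \<zeta>(1) by (rule par_aut_sphere)
      ultimately have "par_aut (real_of_int n * t) \<zeta> \<in> par_arc t \<longleftrightarrow> x + real_of_int n * t \<in> {0..<t}"
        unfolding par_arc_def by (simp only: mem_Collect_eq image_iff of_real_eq_iff) blast
      then show ?thesis by simp
    qed
    then show ?thesis
      unfolding flow using unique_translate[OF t, of x] by simp
  qed
  show "mob (2 + \<i> * of_real (real_of_int n * t)) (- \<i> * of_real (real_of_int n * t)) \<zeta> \<notin> par_arc t"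
    if "\<zeta> \<in> {1}" for \<zeta> n
    using that unfolding flow by (auto simp: par_aut_def disc_conj_def par_arc_def)
  show "jac (2 + \<i> * of_real (real_of_int n * t)) (- \<i> * of_real (real_of_int n * t)) \<zeta>
      \<le> (1 + t\<^sup>2) / (1 + ((real (nat \<bar>n\<bar>) - 1) * t)\<^sup>2)"
    if \<zeta>: "\<zeta> \<in> par_arc t" for n \<zeta>
  proof -
    obtain x where "x \<in> {0..<t}" "cay \<zeta> = of_real x" "\<zeta> \<noteq> 1"
      using \<zeta> unfolding par_arc_def by blast
    then have x: "0 \<le> x" "x < t" and \<zeta>_eq: "\<zeta> = cay_inv (of_real x)"
      using cay_inv_cay[of \<zeta>] by auto
    have le: "((real (nat \<bar>n\<bar>) - 1) * t)\<^sup>2 \<le> (x + real_of_int n * t)\<^sup>2 \<or> n = 0"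
    proof (cases "n \<ge> 0")
      case True
      show ?thesis
      proof (cases "n = 0")
        case False
        then have "1 \<le> real_of_int n" using True by simp
        then have "0 \<le> (real_of_int n - 1) * t" "(real_of_int n - 1) * t \<le> x + real_of_int n * t"
          using t x by (auto simp: left_diff_distrib)
        then have "((real_of_int n - 1) * t)\<^sup>2 \<le> (x + real_of_int n * t)\<^sup>2"
          by (intro power_mono) auto
        then show ?thesis using True by simp
      qed simp
    next
      case False
      then have "real_of_int n * t \<le> - 1 * t" using t by (intro mult_right_mono) auto
      then have "0 \<le> (- real_of_int n - 1) * t" "(- real_of_int n - 1) * t \<le> - (x + real_of_int n * t)"
        using t x by (simp_all add: left_diff_distrib)
      then have "((- real_of_int n - 1) * t)\<^sup>2 \<le> (- (x + real_of_int n * t))\<^sup>2"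
        by (intro power_mono) auto
      then show ?thesis using False by (simp only: power2_minus) simp
    qed
    have xt: "1 + x\<^sup>2 \<le> 1 + t\<^sup>2" using x by (simp add: power_mono)
    have "(1 + x\<^sup>2) / (1 + (x + real_of_int n * t)\<^sup>2) \<le>
        (1 + t\<^sup>2) / (1 + ((real (nat \<bar>n\<bar>) - 1) * t)\<^sup>2)"
    proof (cases "n = 0")
      case True
      have "1 + x\<^sup>2 > 0" "1 + t\<^sup>2 > 0" by (auto intro: add_pos_nonneg)
      then show ?thesis using True by simp
    next
      case False
      then show ?thesis using le xt by (intro frac_le) (auto intro: add_pos_nonneg)
    qed
    then show ?thesis unfolding \<zeta>_eq jac_par .
  qed
  show "(\<integral>\<^sup>+ n. ennreal ((1 + t\<^sup>2) / (1 + ((real (nat \<bar>n\<bar>) - 1) * t)\<^sup>2)) \<partial>count_space (UNIV :: int set)) < \<infinity>"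
  proof (rule nn_integral_int_finite[where h = "\<lambda>k. (1 + t\<^sup>2) / (1 + ((real k - 1) * t)\<^sup>2)"])
    show "summable (\<lambda>k. (1 + t\<^sup>2) / (1 + ((real k - 1) * t)\<^sup>2))"
    proof (rule summable_comparison_test'[where N = 2])
      show "summable (\<lambda>k. (1 + t\<^sup>2) * 4 / t\<^sup>2 * inverse (real k ^ 2))"
        by (intro summable_mult inverse_power_summable) simp
      fix k :: nat assume k: "2 \<le> k"
      have "(real k * t / 2)\<^sup>2 \<le> ((real k - 1) * t)\<^sup>2"
        using k t by (intro power_mono) (auto simp: field_simps)
      then have "(real k * t / 2)\<^sup>2 \<le> 1 + ((real k - 1) * t)\<^sup>2" by linarith
      moreover have "(real k * t / 2)\<^sup>2 > 0" using k t by simp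
      ultimately have "(1 + t\<^sup>2) / (1 + ((real k - 1) * t)\<^sup>2) \<le> (1 + t\<^sup>2) / (real k * t / 2)\<^sup>2"
        by (intro frac_le) simp_all
      also have "\<dots> = (1 + t\<^sup>2) * 4 / t\<^sup>2 * inverse (real k ^ 2)"
        using k t by (simp add: field_simps)
      finally show "norm ((1 + t\<^sup>2) / (1 + ((real k - 1) * t)\<^sup>2)) \<le> (1 + t\<^sup>2) * 4 / t\<^sup>2 * inverse (real k ^ 2)"
        by (simp add: add_nonneg_nonneg)
    qed
  qed (simp add: add_nonneg_nonneg)
qed simp_all

lemma measure_eq_hyp:
  assumes \<alpha>: "\<alpha> > 1" and M: "singular_measure M"
    and eig: "comp_eigenvector (hyp_aut \<alpha>) (sing_inner M)"
  shows "M = nu (hyp_aut \<alpha>) (hyp_aut (1 / \<alpha>)) (restrict_to M (hyp_arc \<alpha>))"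
proof -
  interpret fundamental_domain "\<lambda>n. of_real (\<alpha> powi n + 1)" "\<lambda>n. of_real (\<alpha> powi n - 1)"
    "hyp_aut \<alpha>" "hyp_aut (1 / \<alpha>)" "hyp_arc \<alpha>" "{1, - 1}" "\<lambda>n. (1 + \<alpha>\<^sup>2) * (1 / \<alpha>) ^ nat \<bar>n\<bar>"
    by (rule fundamental_domain_hyp[OF \<alpha>])
  have M': "circle_measure M" by (rule singular_measure_circle[OF M])
  note sets_M = circle_measure.sets_M[OF M']
  have inv: "shift 1 M = M" by (rule eigen_measure_generated(1)[OF M eig])
  have norms: "cmod (of_real (\<alpha> + 1)) = \<alpha> + 1" "cmod (of_real (\<alpha> - 1)) = \<alpha> - 1"
    using \<alpha> unfolding norm_of_real by simp_all
  have "emeasure M {1} = 0"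
  proof (rule fixed_point_null[OF M' inv])
    show "flow 1 1 = 1" using \<alpha> by (simp add: mob_def)
    have "jac (of_real (\<alpha> + 1)) (of_real (\<alpha> - 1)) 1 = 4 * \<alpha> / (2 * \<alpha>)\<^sup>2"
    proof -
      have "cnj (of_real (\<alpha> - 1)) * 1 + cnj (of_real (\<alpha> + 1)) = complex_of_real (2 * \<alpha>)" by simp
      then show ?thesis
        unfolding jac_def norms by (simp only: norm_of_real power2_abs) (simp add: power2_eq_square algebra_simps)
    qed
    then show "speed 1 1 \<noteq> 1" using \<alpha> by (simp add: power2_eq_square)
  qed simp
  moreover have "emeasure M {- 1} = 0"
  proof (rule fixed_point_null[OF M' inv])
    show "flow 1 (- 1) = - 1" by (simp add: mob_def)
    have "jac (of_real (\<alpha> + 1)) (of_real (\<alpha> - 1)) (- 1) = \<alpha>"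
    proof -
      have "cnj (of_real (\<alpha> - 1)) * (- 1) + cnj (of_real (\<alpha> + 1)) = complex_of_real 2" by simp
      then show ?thesis
        unfolding jac_def norms by (simp only: norm_of_real power2_abs) (simp add: power2_eq_square algebra_simps)
    qed
    then show "speed 1 (- 1) \<noteq> 1" using \<alpha> by simp
  qed simp
  moreover have "{1} \<in> sets M" "{- 1} \<in> sets M" by (auto simp: sets_M sets_circle)
  ultimately have null: "{1, - 1} \<in> null_sets M"
    using null_sets.Un[of "{1}" M "{- 1}"] by (simp add: null_sets_def insert_commute)
  show ?thesis
  proof (rule measure_eqI)
    fix G assume G: "G \<in> sets M"
    then show "emeasure M G = emeasure (nu (hyp_aut \<alpha>) (hyp_aut (1 / \<alpha>)) (restrict_to M (hyp_arc \<alpha>))) G"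
      using eigen_measure_generated(2)[OF M eig, of G] emeasure_Diff_null_set[OF null G]
      by (simp add: sets_M)
  qed (simp add: sets_M)
qed

lemma measure_eq_par:
  assumes t: "t > 0" and M: "singular_measure M"
    and eig: "comp_eigenvector (par_aut t) (sing_inner M)"
  shows "M = add_measure (nu (par_aut t) (par_aut (- t)) (restrict_to M (par_arc t)))
    (scale_measure (ennreal (measure M {1})) delta1)" (is "M = add_measure ?N ?D")
proof -
  interpret fundamental_domain "\<lambda>n. 2 + \<i> * of_real (real_of_int n * t)" "\<lambda>n. - \<i> * of_real (real_of_int n * t)"
    "par_aut t" "par_aut (- t)" "par_arc t" "{1}" "\<lambda>n. (1 + t\<^sup>2) / (1 + ((real (nat \<bar>n\<bar>) - 1) * t)\<^sup>2)"
    by (rule fundamental_domain_par[OF t])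
  interpret M: circle_measure M by (rule singular_measure_circle[OF M])
  have one: "{1} \<in> sets M" by (auto simp: sets_circle)
  show ?thesis
  proof (rule measure_eqI)
    fix G assume G: "G \<in> sets M"
    have "emeasure (add_measure ?N ?D) G = emeasure M (G - {1}) + emeasure M {1} * indicator G 1"
      using eigen_measure_generated(2)[OF M eig, of G] G emeasure_add_measure[of ?N ?D G]
      by (simp add: M.emeasure_eq_measure)
    also have "\<dots> = emeasure M G"
    proof (cases "1 \<in> G")
      case True
      then have "emeasure M G = emeasure M ((G - {1}) \<union> {1})" by (simp add: insert_absorb)
      also have "\<dots> = emeasure M (G - {1}) + emeasure M {1}"
        using G one by (intro plus_emeasure[symmetric]) auto
      finally show ?thesis using True by simp
    qed simp
    finally show "emeasure M G = emeasure (add_measure ?N ?D) G" ..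
  qed simp
qed

theorem theorem3p8:
  fixes \<alpha> t :: real
  assumes "\<alpha> > 1" and "t > 0"
  shows
    "(\<forall>\<nu>\<^sub>0. singular_measure \<nu>\<^sub>0 \<and> concentrated_in \<nu>\<^sub>0 (hyp_arc \<alpha>) \<longrightarrow>
        (let \<phi> = hyp_aut \<alpha>; \<nu> = nu \<phi> (hyp_aut (1 / \<alpha>)) \<nu>\<^sub>0 in
          singular_measure \<nu> \<and> singular_inner_function (sing_inner \<nu>) \<and>
          (\<exists>\<gamma>. cmod \<gamma> = 1 \<and> (\<forall>z \<in> ball 0 1. sing_inner \<nu> (\<phi> z) = \<gamma> * sing_inner \<nu> z))))
     \<and> (\<forall>\<mu>. singular_measure \<mu> \<and> comp_eigenvector (hyp_aut \<alpha>) (sing_inner \<mu>) \<longrightarrow>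
        (let \<nu>\<^sub>0 = restrict_to \<mu> (hyp_arc \<alpha>) in
          singular_measure \<nu>\<^sub>0 \<and> concentrated_in \<nu>\<^sub>0 (hyp_arc \<alpha>) \<and>
          \<mu> = nu (hyp_aut \<alpha>) (hyp_aut (1 / \<alpha>)) \<nu>\<^sub>0))
    \<comment> \<open>parabolic\<close>
     \<and> (\<forall>\<nu>\<^sub>0. singular_measure \<nu>\<^sub>0 \<and> concentrated_in \<nu>\<^sub>0 (par_arc t) \<longrightarrow>
        (let \<phi> = par_aut t; \<nu> = nu \<phi> (par_aut (- t)) \<nu>\<^sub>0 in
          (singular_measure \<nu> \<and> singular_inner_function (sing_inner \<nu>) \<and>
           (\<exists>\<gamma>. cmod \<gamma> = 1 \<and> (\<forall>z \<in> ball 0 1. sing_inner \<nu> (\<phi> z) = \<gamma> * sing_inner \<nu> z))) \<and>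
          (\<forall>a \<ge> 0. let \<nu>' = add_measure \<nu> (scale_measure (ennreal a) delta1) in
            singular_measure \<nu>' \<and> singular_inner_function (sing_inner \<nu>') \<and>
            (\<exists>\<gamma>. cmod \<gamma> = 1 \<and>
              (\<forall>z \<in> ball 0 1. sing_inner \<nu>' (\<phi> z) = \<gamma> * sing_inner \<nu>' z)))))
     \<and> (\<forall>\<mu>. singular_measure \<mu> \<and> comp_eigenvector (par_aut t) (sing_inner \<mu>) \<longrightarrow>
        (let \<nu>\<^sub>0 = restrict_to \<mu> (par_arc t) in
          singular_measure \<nu>\<^sub>0 \<and> concentrated_in \<nu>\<^sub>0 (par_arc t) \<and>
          \<mu> = add_measure (nu (par_aut t) (par_aut (- t)) \<nu>\<^sub>0)
                (scale_measure (ennreal (measure \<mu> {1})) delta1)))"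
proof (intro conjI allI impI; (elim conjE)?)
  fix M assume M: "singular_measure M" "concentrated_in M (hyp_arc \<alpha>)"
  note gen = fundamental_domain.generated_measure_eigen[OF fundamental_domain_hyp[OF assms(1)] M]
  show "let \<phi> = hyp_aut \<alpha>; \<nu> = nu \<phi> (hyp_aut (1 / \<alpha>)) M in
      singular_measure \<nu> \<and> singular_inner_function (sing_inner \<nu>) \<and>
      (\<exists>\<gamma>. cmod \<gamma> = 1 \<and> (\<forall>z \<in> ball 0 1. sing_inner \<nu> (\<phi> z) = \<gamma> * sing_inner \<nu> z))"
    unfolding Let_def using gen(1,3) singular_inner_functionI by blast
next
  fix M assume "singular_measure M" "comp_eigenvector (hyp_aut \<alpha>) (sing_inner M)"
  then show "let \<nu>\<^sub>0 = restrict_to M (hyp_arc \<alpha>) in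
      singular_measure \<nu>\<^sub>0 \<and> concentrated_in \<nu>\<^sub>0 (hyp_arc \<alpha>) \<and>
      M = nu (hyp_aut \<alpha>) (hyp_aut (1 / \<alpha>)) \<nu>\<^sub>0"
    unfolding Let_def
    using singular_restrict_to[OF _ hyp_arc_measurable] measure_eq_hyp[OF assms(1)] by blast
next
  fix M assume M: "singular_measure M" "concentrated_in M (par_arc t)"
  interpret fundamental_domain "\<lambda>n. 2 + \<i> * of_real (real_of_int n * t)" "\<lambda>n. - \<i> * of_real (real_of_int n * t)"
    "par_aut t" "par_aut (- t)" "par_arc t" "{1}" "\<lambda>n. (1 + t\<^sup>2) / (1 + ((real (nat \<bar>n\<bar>) - 1) * t)\<^sup>2)"
    by (rule fundamental_domain_par[OF assms(2)])
  let ?\<nu> = "nu (par_aut t) (par_aut (- t)) M"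
  note gen = generated_measure_eigen[OF M]
  have one: "flow 1 1 = 1" "speed 1 1 = 1"
    by (simp_all add: mob_def jac_def cmod_power2)
  have "\<exists>\<gamma>. cmod \<gamma> = 1 \<and> (\<forall>z \<in> ball 0 1. sing_inner \<nu>' (par_aut t z) = \<gamma> * sing_inner \<nu>' z)"
    and "singular_measure \<nu>'"
    if "\<nu>' = add_measure ?\<nu> (scale_measure (ennreal a) delta1)" for \<nu>' a
  proof -
    show s: "singular_measure \<nu>'"
      unfolding that by (rule singular_add_delta1[OF gen(1)])
    have i: "shift 1 \<nu>' = \<nu>'"
      unfolding that by (rule shift_add_delta1[OF sets_nu gen(2) one])
    show "\<exists>\<gamma>. cmod \<gamma> = 1 \<and> (\<forall>z \<in> ball 0 1. sing_inner \<nu>' (par_aut t z) = \<gamma> * sing_inner \<nu>' z)"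
      using invariant_imp_eigen[OF singular_measure_circle[OF s] i] by (simp only: \<phi>_eq[symmetric])
  qed
  then show "let \<phi> = par_aut t; \<nu> = nu \<phi> (par_aut (- t)) M in
      (singular_measure \<nu> \<and> singular_inner_function (sing_inner \<nu>) \<and>
       (\<exists>\<gamma>. cmod \<gamma> = 1 \<and> (\<forall>z \<in> ball 0 1. sing_inner \<nu> (\<phi> z) = \<gamma> * sing_inner \<nu> z))) \<and>
      (\<forall>a \<ge> 0. let \<nu>' = add_measure \<nu> (scale_measure (ennreal a) delta1) in
        singular_measure \<nu>' \<and> singular_inner_function (sing_inner \<nu>') \<and>
        (\<exists>\<gamma>. cmod \<gamma> = 1 \<and> (\<forall>z \<in> ball 0 1. sing_inner \<nu>' (\<phi> z) = \<gamma> * sing_inner \<nu>' z)))"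
    unfolding Let_def using gen(1,3) singular_inner_functionI by blast
next
  fix M assume "singular_measure M" "comp_eigenvector (par_aut t) (sing_inner M)"
  then show "let \<nu>\<^sub>0 = restrict_to M (par_arc t) in
      singular_measure \<nu>\<^sub>0 \<and> concentrated_in \<nu>\<^sub>0 (par_arc t) \<and>
      M = add_measure (nu (par_aut t) (par_aut (- t)) \<nu>\<^sub>0)
            (scale_measure (ennreal (measure M {1})) delta1)"
    unfolding Let_def
    using singular_restrict_to[OF _ par_arc_measurable] measure_eq_par[OF assms(2)] by blast
qed

end
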